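(* For $R=\mathbb{Z}_{25}$ and for $R=\mathbb{S}_5=\mathbb{F}_5[X]/(X^2)$ we have $\mathrm{m}_3(R)\le 43$.
   Context: For a finite chain ring $R$ of length $2$ with residue field $\mathbb{F}_q$, the projective Hjelmslev plane $\mathrm{PHG}(2,R)$ is the incidence structure whose points are the free rank-$1$ submodules of the right module $R_R^3$, whose lines are the free rank-$2$ submodules of $R_R^3$, with incidence given by inclusion. A projective $(k,n)$-arc is a set of $k$ points meeting every line in at most $n$ points. For $0\le n\le q^2+q$, $\mathrm{m}_n(R)$ denotes the largest $k$ such that a projective $(k,n)$-arc exists in $\mathrm{PHG}(2,R)$. *)

theory Defs
  imports Main
begin

record 'a fring =
  rcar :: "'a set"
  radd :: "'a \<Rightarrow> 'a \<Rightarrow> 'a"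
  rmul :: "'a \<Rightarrow> 'a \<Rightarrow> 'a"

definition Z25 :: "nat fring" where
  "Z25 = \<lparr> rcar = {0..<25}, radd = (\<lambda>a b. (a + b) mod 25), rmul = (\<lambda>a b. (a * b) mod 25) \<rparr>"

text \<open>The ring S_5 = F_5[X]/(X^2); the pair (a,b) stands for a + bX.\<close>
definition S5 :: "(nat \<times> nat) fring" where
  "S5 = \<lparr> rcar = {0..<5} \<times> {0..<5},
          radd = (\<lambda>(a,b) (c,d). ((a + c) mod 5, (b + d) mod 5)),
          rmul = (\<lambda>(a,b) (c,d). ((a * c) mod 5, (a * d + b * c) mod 5)) \<rparr>"

definition vecs :: "'a fring \<Rightarrow> ('a \<times> 'a \<times> 'a) set" where
  "vecs R = rcar R \<times> rcar R \<times> rcar R"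

definition smul :: "'a fring \<Rightarrow> ('a \<times> 'a \<times> 'a) \<Rightarrow> 'a \<Rightarrow> ('a \<times> 'a \<times> 'a)" where
  "smul R x r = (case x of (x1, x2, x3) \<Rightarrow> (rmul R x1 r, rmul R x2 r, rmul R x3 r))"

definition vadd :: "'a fring \<Rightarrow> ('a \<times> 'a \<times> 'a) \<Rightarrow> ('a \<times> 'a \<times> 'a) \<Rightarrow> ('a \<times> 'a \<times> 'a)" where
  "vadd R x y = (case x of (x1, x2, x3) \<Rightarrow> case y of (y1, y2, y3) \<Rightarrow>
                   (radd R x1 y1, radd R x2 y2, radd R x3 y3))"

definition free_rank1 :: "'a fring \<Rightarrow> ('a \<times> 'a \<times> 'a) set \<Rightarrow> bool" where
  "free_rank1 R M \<longleftrightarrow> (\<exists>x\<in>vecs R. inj_on (\<lambda>r. smul R x r) (rcar R)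
                                      \<and> M = (\<lambda>r. smul R x r) ` rcar R)"

definition free_rank2 :: "'a fring \<Rightarrow> ('a \<times> 'a \<times> 'a) set \<Rightarrow> bool" where
  "free_rank2 R M \<longleftrightarrow> (\<exists>x\<in>vecs R. \<exists>y\<in>vecs R.
       inj_on (\<lambda>(r, s). vadd R (smul R x r) (smul R y s)) (rcar R \<times> rcar R)
     \<and> M = (\<lambda>(r, s). vadd R (smul R x r) (smul R y s)) ` (rcar R \<times> rcar R))"

definition phg_points :: "'a fring \<Rightarrow> ('a \<times> 'a \<times> 'a) set set" where
  "phg_points R = {M. free_rank1 R M}"

definition phg_lines :: "'a fring \<Rightarrow> ('a \<times> 'a \<times> 'a) set set" where
  "phg_lines R = {M. free_rank2 R M}"

definition proj_arc :: "'a fring \<Rightarrow> nat \<Rightarrow> nat \<Rightarrow> ('a \<times> 'a \<times> 'a) set set \<Rightarrow> bool" where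
  "proj_arc R k n S \<longleftrightarrow> S \<subseteq> phg_points R \<and> card S = k
     \<and> (\<forall>L\<in>phg_lines R. card {P\<in>S. P \<subseteq> L} \<le> n)"

definition m_arc :: "'a fring \<Rightarrow> nat \<Rightarrow> nat" where
  "m_arc R n = Max {k. \<exists>S. proj_arc R k n S}"

end

theory Submission
  imports Defs
begin

text \<open>
  The 31 neighbour classes of points and the 31 neighbour classes of lines form PG(2,5). Let \<open>u x\<close> be
  the number of points of a hypothetical 44-arc in the class \<open>x\<close>. If \<open>m\<close> of them lie on one segment
  in the direction of a line class \<open>l\<close> through \<open>x\<close>, the five lines of \<open>l\<close> through this segment
  partition the other points of \<open>l\<close>, which therefore carries at most \<open>5 * (3 - m)\<close> points outside \<open>x\<close>.
  Summing over the six directions at \<open>x\<close> and counting the directions determined by the points in \<open>x\<close>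
  rules out \<open>u x \<ge> 4\<close>. Then a line class carries at most 11 points, as otherwise it yields a
  (12,3)-arc in the dual of PG(2,5), and this rules out \<open>u x = 3\<close>. So all \<open>u x\<close> are at most 2; let
  \<open>n\<close> classes have two points. Each of these determines a direction, the corresponding line classes
  are distinct, and they carry at most 7 points. With \<open>w\<close> the weight of a line class, the sum of
  \<open>(w - 10) * (w - 11)\<close> is \<open>22 + 10 * n\<close>, but it is at least \<open>12 * n\<close>, so \<open>n \<le> 11\<close>. On the other
  hand \<open>44 \<le> 31 + n\<close>.
\<close>

section \<open>Projective planes of order five\<close>

text \<open>The conditions are self-dual, so every counting result also holds with points and lines
  exchanged. They are used twice: for the plane of neighbour classes and for the dual plane attached
  to one line class.\<close>

locale pplane5 =
  fixes Q :: "'a set" and L :: "'b set" and inc :: "'a \<Rightarrow> 'b \<Rightarrow> bool"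
  assumes card_points: "card Q = 31"
    and card_lines: "card L = 31"
    and degree: "p \<in> Q \<Longrightarrow> card {l \<in> L. inc p l} = 6"
    and size: "l \<in> L \<Longrightarrow> card {p \<in> Q. inc p l} = 6"
    and join: "\<lbrakk>p \<in> Q; q \<in> Q; p \<noteq> q\<rbrakk> \<Longrightarrow> card {l \<in> L. inc p l \<and> inc q l} = 1"
    and meet: "\<lbrakk>l \<in> L; k \<in> L; l \<noteq> k\<rbrakk> \<Longrightarrow> card {p \<in> Q. inc p l \<and> inc p k} = 1"
begin

lemma finite_points: "finite Q"
  using card_points by (metis card.infinite zero_neq_numeral)

lemma finite_lines: "finite L"
  using card_lines by (metis card.infinite zero_neq_numeral)

abbreviation on :: "'b \<Rightarrow> 'a set" where
  "on l \<equiv> {p \<in> Q. inc p l}"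

section \<open>Double counting of line weights\<close>

lemma sum_line_weights:
  fixes f :: "'a \<Rightarrow> int"
  shows "(\<Sum>l\<in>L. \<Sum>p\<in>on l. f p) = 6 * (\<Sum>p\<in>Q. f p)"
proof -
  have "(\<Sum>l\<in>L. \<Sum>p\<in>on l. f p) = (\<Sum>p\<in>Q. \<Sum>l\<in>{l \<in> L. inc p l}. f p)"
    by (rule sum.swap_restrict [OF finite_lines finite_points])
  also have "\<dots> = (\<Sum>p\<in>Q. 6 * f p)"
    by (rule sum.cong) (auto simp: degree)
  finally show ?thesis by (simp add: sum_distrib_left)
qed

text \<open>Expanding the squares gives products over ordered pairs of points. A pair of distinct
  points lies on one line, a repeated point on six, which leaves five extra copies of the
  diagonal.\<close>

lemma sum_line_weights_squared:
  fixes f :: "'a \<Rightarrow> int"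
  shows "(\<Sum>l\<in>L. (\<Sum>p\<in>on l. f p)\<^sup>2) = (\<Sum>p\<in>Q. f p)\<^sup>2 + 5 * (\<Sum>p\<in>Q. (f p)\<^sup>2)"
proof -
  have restr: "(\<Sum>p\<in>on l. f p) = (\<Sum>p\<in>Q. if inc p l then f p else 0)" for l
    by (rule sum.inter_filter [OF finite_points])
  have "(\<Sum>l\<in>L. (\<Sum>p\<in>on l. f p)\<^sup>2)
      = (\<Sum>l\<in>L. \<Sum>p\<in>Q. \<Sum>q\<in>Q. if inc p l \<and> inc q l then f p * f q else 0)"
    unfolding restr power2_eq_square sum_product
    by (intro sum.cong) auto
  also have "\<dots> = (\<Sum>p\<in>Q. \<Sum>q\<in>Q. \<Sum>l\<in>L. if inc p l \<and> inc q l then f p * f q else 0)"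
    by (subst sum.swap, rule sum.cong, rule refl, subst sum.swap, rule refl)
  also have "\<dots> = (\<Sum>p\<in>Q. \<Sum>q\<in>Q. f p * f q * int (card {l \<in> L. inc p l \<and> inc q l}))"
    by (intro sum.cong refl) (simp add: sum.inter_filter [OF finite_lines, symmetric])
  also have "\<dots> = (\<Sum>p\<in>Q. \<Sum>q\<in>Q. f p * f q + (if p = q then 5 * (f p)\<^sup>2 else 0))"
    by (intro sum.cong refl) (auto simp: degree join power2_eq_square)
  also have "\<dots> = (\<Sum>p\<in>Q. \<Sum>q\<in>Q. f p * f q) + (\<Sum>p\<in>Q. 5 * (f p)\<^sup>2)"
    by (simp add: sum.distrib finite_points)
  also have "(\<Sum>p\<in>Q. \<Sum>q\<in>Q. f p * f q) = (\<Sum>p\<in>Q. f p)\<^sup>2"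
    by (simp only: power2_eq_square sum_product)
  finally show ?thesis
    by (simp add: sum_distrib_left)
qed

text \<open>The lines through \<open>p\<close> partition the remaining points.\<close>

lemma sum_through:
  fixes f :: "'a \<Rightarrow> int"
  assumes p: "p \<in> Q"
  shows "(\<Sum>l\<in>{l \<in> L. inc p l}. \<Sum>q\<in>on l - {p}. f q) = (\<Sum>q\<in>Q - {p}. f q)"
proof -
  have "(\<Sum>l\<in>{l \<in> L. inc p l}. \<Sum>q\<in>on l - {p}. f q)
      = (\<Sum>l\<in>{l \<in> L. inc p l}. \<Sum>q\<in>{q \<in> Q - {p}. inc q l}. f q)"
    by (intro sum.cong refl) auto
  also have "\<dots> = (\<Sum>q\<in>Q - {p}. \<Sum>l\<in>{l \<in> {l \<in> L. inc p l}. inc q l}. f q)"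
    by (rule sum.swap_restrict) (use finite_lines finite_points in auto)
  also have "\<dots> = (\<Sum>q\<in>Q - {p}. f q)"
  proof (intro sum.cong refl)
    fix q assume "q \<in> Q - {p}"
    then have "card {l \<in> L. inc p l \<and> inc q l} = 1" using join p by auto
    then show "(\<Sum>l\<in>{l \<in> {l \<in> L. inc p l}. inc q l}. f q) = f q" by simp
  qed
  finally show ?thesis .
qed

lemma dual: "pplane5 L Q (\<lambda>l p. inc p l)"
  by unfold_locales (use card_points card_lines degree size join meet in auto)

text \<open>A (12,3)-arc has no tangents, hence exactly five external lines. Counting how these five
  meet at the points of the plane, by the same identities in the dual, gives a
  contradiction.\<close>

lemma no_12_3_arc:
  assumes A: "A \<subseteq> Q" "card A = 12"
    and arc: "\<And>l. l \<in> L \<Longrightarrow> card {p \<in> A. inc p l} \<le> 3"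
  shows False
proof -
  interpret d: pplane5 L Q "\<lambda>l p. inc p l" by (rule dual)
  have finA: "finite A" using A finite_points finite_subset by blast
  have QA: "Q \<inter> A = A" using A by auto
  define f where "f p = (if p \<in> A then 1 else 0 :: int)" for p
  define m where "m l = (\<Sum>p\<in>on l. f p)" for l
  have m_card: "m l = int (card {p \<in> A. inc p l})" for l
  proof -
    have "m l = (\<Sum>p\<in>on l \<inter> A. 1)"
      unfolding m_def f_def by (rule sum.inter_restrict [symmetric]) (simp add: finite_points)
    also have "on l \<inter> A = {p \<in> A. inc p l}" using A by auto
    finally show ?thesis by simp
  qed
  have sumf: "(\<Sum>p\<in>Q. f p) = 12"
    using A by (simp add: f_def sum.inter_restrict [OF finite_points, symmetric] QA)
  have sumf2: "(\<Sum>p\<in>Q. (f p)\<^sup>2) = 12"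
  proof -
    have "(\<Sum>p\<in>Q. (f p)\<^sup>2) = (\<Sum>p\<in>Q. f p)" by (rule sum.cong) (auto simp: f_def)
    then show ?thesis using sumf by simp
  qed
  have m_range: "m l = 0 \<or> m l = 2 \<or> m l = 3" if l: "l \<in> L" for l
  proof (cases "{p \<in> A. inc p l} = {}")
    case True
    then show ?thesis using m_card [of l] by (simp only: card.empty of_nat_0 simp_thms)
  next
    case False
    then obtain p where p: "p \<in> A" "inc p l" by auto
    then have pQ: "p \<in> Q" using A by auto
    have step: "(\<Sum>q\<in>on k - {p}. f q) = m k - 1" if "k \<in> L" "inc p k" for k
      unfolding m_def using that p pQ finite_points by (subst sum_diff1) (auto simp: f_def)
    have "(\<Sum>k\<in>{k \<in> L. inc p k}. m k - 1) = (\<Sum>q\<in>Q - {p}. f q)"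
      using sum_through [OF pQ, of f] by (simp add: step)
    also have "\<dots> = 11"
      using sumf pQ p finite_points by (subst sum_diff1) (auto simp: f_def)
    finally have eleven: "(\<Sum>k\<in>{k \<in> L. inc p k}. m k - 1) = 11" .
    have fin: "finite {k \<in> L. inc p k}" using finite_lines by auto
    \<comment> \<open>The five other lines through \<open>p\<close> carry at most two further points
      each, so at least one of the eleven further points lies on \<open>l\<close>.\<close>
    have "(\<Sum>k\<in>{k \<in> L. inc p k} - {l}. m k - 1) \<le> (\<Sum>k\<in>{k \<in> L. inc p k} - {l}. 2)"
      by (rule sum_mono) (use arc in \<open>force simp: m_card\<close>)
    also have "\<dots> = 10" using degree [OF pQ] l p fin by (simp add: card_Diff_singleton)
    finally have "m l - 1 \<ge> 1"
      using eleven l p fin by (subst (asm) sum_diff1) auto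
    moreover have "m l \<le> 3" using arc [OF l] by (simp add: m_card)
    ultimately show ?thesis by linarith
  qed
  define Z where "Z = {l \<in> L. m l = 0}"
  \<comment> \<open>The summand is (m - 2)(m - 3), which is 6 on external lines and 0 on all others.
    The total is 204 - 360 + 186 = 30, so five lines are external.\<close>
  have "(\<Sum>l\<in>L. (m l)\<^sup>2 - 5 * m l + 6) = (\<Sum>l\<in>L. (m l)\<^sup>2) - 5 * (\<Sum>l\<in>L. m l) + 6 * 31"
    by (simp add: sum.distrib sum_subtractf sum_distrib_left card_lines)
  also have "\<dots> = 30"
    unfolding m_def sum_line_weights sum_line_weights_squared by (simp add: sumf sumf2)
  finally have "(\<Sum>l\<in>L. (m l)\<^sup>2 - 5 * m l + 6) = 30" .
  moreover have "(\<Sum>l\<in>L. (m l)\<^sup>2 - 5 * m l + 6) = (\<Sum>l\<in>L. if m l = 0 then 6 else 0)"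
    by (rule sum.cong) (use m_range in force)+
  moreover have "(\<Sum>l\<in>L. if m l = 0 then 6 else 0) = (\<Sum>l\<in>Z. 6 :: int)"
    unfolding Z_def by (rule sum.inter_filter [OF finite_lines, symmetric])
  ultimately have "(\<Sum>l\<in>Z. 6) = (30::int)" by (simp only:)
  then have cardZ: "card Z = 5" by simp
  have LZ: "L \<inter> Z = Z" by (auto simp: Z_def)
  define g where "g l = (if l \<in> Z then 1 else 0 :: int)" for l
  define z where "z p = (\<Sum>l\<in>d.on p. g l)" for p
  have sumg: "(\<Sum>l\<in>L. g l) = 5"
    by (simp add: g_def sum.inter_restrict [OF finite_lines, symmetric] LZ cardZ)
  have sumg2: "(\<Sum>l\<in>L. (g l)\<^sup>2) = 5"
  proof -
    have "(\<Sum>l\<in>L. (g l)\<^sup>2) = (\<Sum>l\<in>L. g l)" by (rule sum.cong) (auto simp: g_def)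
    then show ?thesis using sumg by simp
  qed
  have zA: "z p = 0" if "p \<in> A" for p
    unfolding z_def
  proof (rule sum.neutral, rule ballI)
    fix l assume l: "l \<in> d.on p"
    then have "{p \<in> A. inc p l} \<noteq> {}" using that by auto
    then have "m l \<noteq> 0" using finA by (simp add: m_card)
    then show "g l = 0" by (simp add: g_def Z_def)
  qed
  \<comment> \<open>Here \<open>z p\<close> is the number of external lines through
    \<open>p\<close>. The summand (z - 1)(z - 2) is never negative on integers and equals 2 on the
    twelve points of \<open>A\<close>, but the total is only 50 - 90 + 62 = 22.\<close>
  have "(\<Sum>p\<in>Q. (z p)\<^sup>2 - 3 * z p + 2) = (\<Sum>p\<in>Q. (z p)\<^sup>2) - 3 * (\<Sum>p\<in>Q. z p) + 2 * 31"
    by (simp add: sum.distrib sum_subtractf sum_distrib_left card_points)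
  also have "\<dots> = 22"
    unfolding z_def d.sum_line_weights d.sum_line_weights_squared by (simp add: sumg sumg2)
  finally have "(\<Sum>p\<in>Q. (z p)\<^sup>2 - 3 * z p + 2) = 22" .
  moreover have "(\<Sum>p\<in>Q. (z p)\<^sup>2 - 3 * z p + 2) \<ge> (\<Sum>p\<in>A. (z p)\<^sup>2 - 3 * z p + 2)"
  proof (rule sum_mono2 [OF finite_points A(1)])
    fix p
    have "(z p - 1) * (z p - 2) \<ge> 0"
      by (cases "z p \<le> 1") (auto simp: mult_nonpos_nonpos)
    then show "0 \<le> (z p)\<^sup>2 - 3 * z p + 2" by (simp add: power2_eq_square algebra_simps)
  qed
  moreover have "(\<Sum>p\<in>A. (z p)\<^sup>2 - 3 * z p + 2) = 24"
    using A by (simp add: zA)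
  ultimately show False by simp
qed

end

section \<open>Arcs with neighbour classes\<close>

text \<open>\<open>S x\<close> is the part of the arc in the point class \<open>x\<close>, and \<open>seg l x s\<close> numbers the five segments of \<open>x\<close>
  in the direction of the line class \<open>l\<close>. The lines in \<open>l\<close> are indexed by \<open>T l\<close>; the line \<open>t\<close> contains
  the segment of \<open>x\<close> with number \<open>val l t x\<close>.\<close>
locale hj_arc = pplane5 C D I
  for C :: "'c set" and D :: "'d set" and I :: "'c \<Rightarrow> 'd \<Rightarrow> bool" +
  fixes S :: "'c \<Rightarrow> 's set" and seg :: "'d \<Rightarrow> 'c \<Rightarrow> 's \<Rightarrow> int"
    and T :: "'d \<Rightarrow> 't set" and val :: "'d \<Rightarrow> 't \<Rightarrow> 'c \<Rightarrow> int"
  assumes finite_S: "finite (S x)"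
    and seg_range: "seg l x s \<in> {0..<5}"
    and val_range: "val l t x \<in> {0..<5}"
    and card_T: "l \<in> D \<Longrightarrow> card (T l) = 25"
    and val_bij: "\<lbrakk>l \<in> D; x \<in> C; y \<in> C; I x l; I y l; x \<noteq> y; j \<in> {0..<5}\<rbrakk>
      \<Longrightarrow> bij_betw (\<lambda>t. val l t y) {t \<in> T l. val l t x = j} {0..<5}"
    and val_meet: "\<lbrakk>l \<in> D; t \<in> T l; t' \<in> T l; t \<noteq> t'\<rbrakk>
      \<Longrightarrow> \<exists>!x. x \<in> C \<and> I x l \<and> val l t x = val l t' x"
    and direction: "\<lbrakk>x \<in> C; s \<in> S x; s' \<in> S x; s \<noteq> s'\<rbrakk>
      \<Longrightarrow> \<exists>!l. l \<in> D \<and> I x l \<and> seg l x s = seg l x s'"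
    and fano: "\<lbrakk>x \<in> C; {a, b, c, d} \<subseteq> S x; distinct [a, b, c, d];
        l\<^sub>1 \<in> D; l\<^sub>2 \<in> D; l\<^sub>3 \<in> D; I x l\<^sub>1; I x l\<^sub>2; I x l\<^sub>3; distinct [l\<^sub>1, l\<^sub>2, l\<^sub>3];
        seg l\<^sub>1 x a = seg l\<^sub>1 x b; seg l\<^sub>1 x c = seg l\<^sub>1 x d;
        seg l\<^sub>2 x a = seg l\<^sub>2 x c; seg l\<^sub>2 x b = seg l\<^sub>2 x d;
        seg l\<^sub>3 x a = seg l\<^sub>3 x d; seg l\<^sub>3 x b = seg l\<^sub>3 x c\<rbrakk> \<Longrightarrow> False"
    and arc: "\<lbrakk>l \<in> D; t \<in> T l\<rbrakk>
      \<Longrightarrow> (\<Sum>x\<in>{x \<in> C. I x l}. card {s \<in> S x. seg l x s = val l t x}) \<le> 3"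
begin

section \<open>Segments and the points outside a class\<close>

definition u :: "'c \<Rightarrow> int" where
  "u x = int (card (S x))"

definition mult :: "'d \<Rightarrow> 'c \<Rightarrow> int \<Rightarrow> int" where
  "mult l x j = int (card {s \<in> S x. seg l x s = j})"

definition rest :: "'d \<Rightarrow> 'c \<Rightarrow> int" where
  "rest l x = (\<Sum>y\<in>on l - {x}. u y)"

abbreviation through :: "'c \<Rightarrow> 'd set" where
  "through x \<equiv> {l \<in> D. I x l}"

lemma finite_on: "finite (on l)"
  using finite_points by simp

lemma finite_T: "l \<in> D \<Longrightarrow> finite (T l)"
  using card_T by (metis card.infinite zero_neq_numeral)

lemma u_nonneg: "u x \<ge> 0"
  by (simp add: u_def)

lemma arc_mult: "\<lbrakk>l \<in> D; t \<in> T l\<rbrakk> \<Longrightarrow> (\<Sum>x\<in>on l. mult l x (val l t x)) \<le> 3"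
  unfolding mult_def of_nat_sum [symmetric] using arc by (simp del: of_nat_sum)

lemma sum_mult: "(\<Sum>j\<in>{0..<5}. mult l x j) = u x"
proof -
  have "card (S x) = (\<Sum>j\<in>{0..<5}. card {s \<in> S x. seg l x s = j})"
    using card_UN_disjoint [of "{0..<5::int}" "\<lambda>j. {s \<in> S x. seg l x s = j}"] finite_S seg_range
    by (subst card_UN_disjoint [symmetric]) (auto intro!: arg_cong [where f = card])
  then show ?thesis by (simp add: u_def mult_def)
qed

lemma other_point:
  assumes "l \<in> D" "x \<in> C" "I x l"
  obtains y where "y \<in> C" "I y l" "y \<noteq> x"
proof -
  have "card (on l - {x}) = 5" using size assms by (simp add: card_Diff_singleton)
  then have "on l - {x} \<noteq> {}" by (metis card.empty zero_neq_numeral)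
  then show ?thesis using that by blast
qed

lemma card_pencil:
  assumes "l \<in> D" "x \<in> C" "I x l" "j \<in> {0..<5}"
  shows "card {t \<in> T l. val l t x = j} = 5"
proof -
  obtain y where "y \<in> C" "I y l" "y \<noteq> x" using other_point assms(1-3) by blast
  then show ?thesis using bij_betw_same_card [OF val_bij [of l x y j]] assms by simp
qed

text \<open>The five lines of \<open>l\<close> through the segment \<open>j\<close> of
  \<open>x\<close> carry at most 15 points counted with multiplicity. The points on the segment are
  counted five times, and every point of \<open>l\<close> outside \<open>x\<close> exactly
  once.\<close>

lemma rest_bound:
  assumes l: "l \<in> D" "x \<in> C" "I x l" and j: "j \<in> {0..<5}"
  shows "5 * mult l x j + rest l x \<le> 15"
proof -
  let ?P = "{t \<in> T l. val l t x = j}"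
  have x: "x \<in> on l" using l by simp
  have split: "(\<Sum>y\<in>on l. mult l y (val l t y)) = mult l x j + (\<Sum>y\<in>on l - {x}. mult l y (val l t y))"
    if "t \<in> ?P" for t
    using that by (subst sum.remove [OF finite_on x]) auto
  have pencil: "(\<Sum>t\<in>?P. mult l y (val l t y)) = u y" if "y \<in> on l - {x}" for y
  proof -
    have "(\<Sum>t\<in>?P. mult l y (val l t y)) = (\<Sum>k\<in>{0..<5}. mult l y k)"
      by (rule sum.reindex_bij_betw [OF val_bij]) (use that l j in auto)
    then show ?thesis by (simp only: sum_mult)
  qed
  have "(\<Sum>t\<in>?P. \<Sum>y\<in>on l. mult l y (val l t y)) \<le> (\<Sum>t\<in>?P. 3)"
    by (rule sum_mono) (use arc_mult l in auto)
  also have "\<dots> = 15" by (simp add: card_pencil [OF l j])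
  finally have "(\<Sum>t\<in>?P. mult l x j + (\<Sum>y\<in>on l - {x}. mult l y (val l t y))) \<le> 15"
    by (simp only: split cong: sum.cong)
  moreover have "(\<Sum>t\<in>?P. \<Sum>y\<in>on l - {x}. mult l y (val l t y))
      = (\<Sum>y\<in>on l - {x}. \<Sum>t\<in>?P. mult l y (val l t y))"
    by (rule sum.swap)
  moreover have "\<dots> = rest l x" unfolding rest_def by (rule sum.cong) (use pencil in auto)
  ultimately show ?thesis by (simp add: sum.distrib card_pencil [OF l j])
qed

lemma mult_ge:
  assumes "A \<subseteq> S x" "\<And>s. s \<in> A \<Longrightarrow> seg l x s = j"
  shows "int (card A) \<le> mult l x j"
  unfolding mult_def using assms by (auto intro!: card_mono finite_S)

lemma rest_bound_subset:
  assumes l: "l \<in> D" "x \<in> C" "I x l" and A: "A \<subseteq> S x" "A \<noteq> {}"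
    and same: "\<And>s s'. s \<in> A \<Longrightarrow> s' \<in> A \<Longrightarrow> seg l x s = seg l x s'"
  shows "5 * int (card A) + rest l x \<le> 15"
proof -
  obtain s where s: "s \<in> A" using A by auto
  have "int (card A) \<le> mult l x (seg l x s)" by (rule mult_ge [OF A(1)]) (rule same [OF _ s])
  then show ?thesis using rest_bound [OF l seg_range [of l x s]] by linarith
qed

lemma rest_nonneg: "rest l x \<ge> 0"
  unfolding rest_def by (rule sum_nonneg) (simp add: u_nonneg)

section \<open>Directions determined inside a point class\<close>

definition dr :: "'c \<Rightarrow> 's \<Rightarrow> 's \<Rightarrow> 'd" where
  "dr x s s' = (THE l. l \<in> D \<and> I x l \<and> seg l x s = seg l x s')"

lemma dr:
  assumes "x \<in> C" "s \<in> S x" "s' \<in> S x" "s \<noteq> s'"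
  shows "dr x s s' \<in> D" "I x (dr x s s')" "seg (dr x s s') x s = seg (dr x s s') x s'"
  using theI' [OF direction [OF assms]] by (auto simp: dr_def)

lemma dr_unique:
  assumes "x \<in> C" "s \<in> S x" "s' \<in> S x" "s \<noteq> s'"
    and "l \<in> D" "I x l" "seg l x s = seg l x s'"
  shows "dr x s s' = l"
  using direction [OF assms(1-4)] dr [OF assms(1-4)] assms(5-7) by blast

lemma dr_sym: "dr x s s' = dr x s' s"
  unfolding dr_def by (rule arg_cong [where f = The]) (auto simp: fun_eq_iff)

lemma dr_trans:
  assumes "x \<in> C" "a \<in> S x" "b \<in> S x" "c \<in> S x" "a \<noteq> b" "a \<noteq> c" "b \<noteq> c" "dr x a b = dr x b c"
  shows "dr x a c = dr x a b"
proof (rule dr_unique)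
  show "seg (dr x a b) x a = seg (dr x a b) x c"
    using dr(3) [of x a b] dr(3) [of x b c] assms by simp
qed (use assms dr [of x a b] in auto)

definition Det :: "'c \<Rightarrow> 'd set" where
  "Det x = {dr x s s' |s s'. s \<in> S x \<and> s' \<in> S x \<and> s \<noteq> s'}"

lemma Det_through: "x \<in> C \<Longrightarrow> Det x \<subseteq> through x"
  unfolding Det_def using dr by auto

lemma finite_Det: "x \<in> C \<Longrightarrow> finite (Det x)"
  by (rule finite_subset [OF Det_through]) (simp_all add: finite_lines)

lemma rest_Det:
  assumes x: "x \<in> C" and l: "l \<in> Det x"
  shows "rest l x \<le> 5"
proof -
  obtain s s' where s: "s \<in> S x" "s' \<in> S x" "s \<noteq> s'" "l = dr x s s'"
    using l by (auto simp: Det_def)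
  have "5 * int (card {s, s'}) + rest l x \<le> 15"
    by (rule rest_bound_subset) (use s x dr [of x s s'] in auto)
  then show ?thesis using s by simp
qed

lemma rest_any:
  assumes x: "x \<in> C" "l \<in> D" "I x l" and "S x \<noteq> {}"
  shows "rest l x \<le> 10"
proof -
  obtain s where "s \<in> S x" using assms by auto
  then have "5 * int (card {s}) + rest l x \<le> 15"
    by (intro rest_bound_subset) (use x in auto)
  then show ?thesis by simp
qed

lemma rest_triple:
  assumes x: "x \<in> C" and s: "{a, b, c} \<subseteq> S x" "distinct [a, b, c]" "dr x a b = dr x b c"
  shows "rest (dr x a b) x = 0"
proof -
  have "5 * int (card {a, b, c}) + rest (dr x a b) x \<le> 15"
    by (rule rest_bound_subset) (use s x dr [of x a b] dr [of x b c] in auto)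
  then show ?thesis using s rest_nonneg [of "dr x a b" x] by auto
qed

text \<open>Four points on one segment would already contribute 20 to the bound 15.\<close>

lemma no_quadruple:
  assumes x: "x \<in> C" and s: "{a, b, c, d} \<subseteq> S x" "distinct [a, b, c, d]" "dr x a b = dr x b c"
  shows "dr x a b \<noteq> dr x a d"
proof
  assume e: "dr x a b = dr x a d"
  have "5 * int (card {a, b, c, d}) + rest (dr x a b) x \<le> 15"
    by (rule rest_bound_subset) (use s x e dr [of x a b] dr [of x b c] dr [of x a d] in auto)
  then show False using s rest_nonneg [of "dr x a b" x] by auto
qed

section \<open>Summation over the six directions at a class\<close>

definition total :: int where
  "total = (\<Sum>x\<in>C. u x)"

lemma sum_rest:
  assumes "x \<in> C"
  shows "(\<Sum>l\<in>through x. rest l x) = total - u x"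
  unfolding rest_def sum_through [OF assms] total_def
  using assms finite_points by (subst sum_diff1) auto

lemma total_bound:
  assumes x: "x \<in> C" and Ls: "Ls \<subseteq> through x"
    and a: "\<And>l. l \<in> Ls \<Longrightarrow> rest l x \<le> a" and b: "\<And>l. l \<in> through x - Ls \<Longrightarrow> rest l x \<le> b"
  shows "total - u x \<le> a * int (card Ls) + b * (6 - int (card Ls))"
proof -
  have fin: "finite (through x)" using finite_lines by simp
  have finLs: "finite Ls" using Ls fin finite_subset by blast
  have le: "card Ls \<le> 6" using card_mono [OF fin Ls] degree [OF x] by simp
  have "total - u x = (\<Sum>l\<in>through x - Ls. rest l x) + (\<Sum>l\<in>Ls. rest l x)"
    using sum.subset_diff [OF Ls fin] sum_rest [OF x] by metis
  also have "\<dots> \<le> (\<Sum>l\<in>through x - Ls. b) + (\<Sum>l\<in>Ls. a)"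
    by (intro add_mono sum_mono a b)
  also have "\<dots> = a * int (card Ls) + b * (6 - int (card Ls))"
    using card_Diff_subset [OF finLs Ls] degree [OF x] le by (simp add: of_nat_diff)
  finally show ?thesis .
qed

text \<open>A direction carrying three collinear points of the class has nothing outside it, which
  saves one further \<open>a\<close> compared with \<open>total_bound\<close>.\<close>

lemma total_bound_zero:
  assumes x: "x \<in> C" and Ls: "Ls \<subseteq> through x" and l0: "l0 \<in> Ls" "rest l0 x = 0"
    and a: "\<And>l. l \<in> Ls \<Longrightarrow> rest l x \<le> a" and b: "\<And>l. l \<in> through x - Ls \<Longrightarrow> rest l x \<le> b"
  shows "total - u x \<le> a * (int (card Ls) - 1) + b * (6 - int (card Ls))"
proof -
  have fin: "finite (through x)" using finite_lines by simp
  have finLs: "finite Ls" using Ls fin finite_subset by blast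
  have le: "card Ls \<le> 6" using card_mono [OF fin Ls] degree [OF x] by simp
  have pos: "card Ls \<ge> 1" using l0 finLs by (metis One_nat_def Suc_leI card_gt_0_iff empty_iff)
  have "total - u x = (\<Sum>l\<in>through x - Ls. rest l x) + (\<Sum>l\<in>Ls. rest l x)"
    using sum.subset_diff [OF Ls fin] sum_rest [OF x] by metis
  also have "(\<Sum>l\<in>Ls. rest l x) = (\<Sum>l\<in>Ls - {l0}. rest l x)"
    using l0 finLs by (simp add: sum_diff1)
  also have "(\<Sum>l\<in>through x - Ls. rest l x) + (\<Sum>l\<in>Ls - {l0}. rest l x)
      \<le> (\<Sum>l\<in>through x - Ls. b) + (\<Sum>l\<in>Ls - {l0}. a)"
    by (intro add_mono sum_mono a b) auto
  also have "\<dots> = a * (int (card Ls) - 1) + b * (6 - int (card Ls))"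
    using card_Diff_subset [OF finLs Ls] degree [OF x] le pos l0
    by (simp add: of_nat_diff)
  finally show ?thesis .
qed

section \<open>Lower bounds for the number of determined directions\<close>

lemma DetI: "\<lbrakk>s \<in> S x; s' \<in> S x; s \<noteq> s'\<rbrakk> \<Longrightarrow> dr x s s' \<in> Det x"
  unfolding Det_def by blast

lemma card_Det_ge:
  assumes "x \<in> C" "set ls \<subseteq> Det x" "distinct ls"
  shows "length ls \<le> card (Det x)"
  using card_mono [OF finite_Det assms(2)] assms distinct_card by metis

text \<open>The point \<open>d\<close> lies off the segment containing \<open>a\<close>,
  \<open>b\<close>, \<open>c\<close>, so its joins to them have three different directions, all
  different from that of the segment.\<close>

lemma Det_triple:
  assumes x: "x \<in> C" and s: "{a, b, c, d} \<subseteq> S x" "distinct [a, b, c, d]" "dr x a b = dr x b c"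
  shows "card (Det x) \<ge> 4"
proof -
  have ac: "dr x a c = dr x a b" using dr_trans [of x a b c] x s by simp
  have ad: "dr x a b \<noteq> dr x a d" using no_quadruple [OF x s] .
  have bd: "dr x a b \<noteq> dr x b d" using ad dr_trans [of x a b d] x s by auto
  have cd: "dr x a b \<noteq> dr x c d" using ad ac dr_trans [of x a c d] x s by auto
  have 1: "dr x a d \<noteq> dr x b d" using ad dr_trans [of x a d b] dr_sym [of x b d] x s by auto
  have 2: "dr x a d \<noteq> dr x c d" using ad ac dr_trans [of x a d c] dr_sym [of x c d] x s by auto
  have 3: "dr x b d \<noteq> dr x c d"
    using bd s(3) dr_trans [of x b d c] dr_sym [of x c d] x s by auto
  have "length [dr x a b, dr x a d, dr x b d, dr x c d] \<le> card (Det x)"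
    by (rule card_Det_ge [OF x]) (use s ad bd cd 1 2 3 in \<open>auto intro!: DetI\<close>)
  then show ?thesis by simp
qed

text \<open>No three arc points of the class lie on a common segment.\<close>

definition general_position :: "'c \<Rightarrow> bool" where
  "general_position x \<longleftrightarrow>
    (\<forall>a\<in>S x. \<forall>b\<in>S x. \<forall>c\<in>S x. distinct [a, b, c] \<longrightarrow> dr x a b \<noteq> dr x b c)"

lemma general_positionD:
  "\<lbrakk>general_position x; a \<in> S x; b \<in> S x; c \<in> S x; a \<noteq> b; a \<noteq> c; b \<noteq> c\<rbrakk>
    \<Longrightarrow> dr x a b \<noteq> dr x b c \<and> dr x b a \<noteq> dr x b c \<and> dr x b a \<noteq> dr x c b \<and> dr x a b \<noteq> dr x c b"
  unfolding general_position_def by (metis dr_sym distinct_length_2_or_more distinct_singleton)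

text \<open>The joins of \<open>a\<close> to the other points give three directions. If there were
  no fourth, all three pairs of opposite sides of the quadrangle would be parallel, which
  \<open>fano\<close> excludes.\<close>

lemma Det_quadrangle:
  assumes x: "x \<in> C" and s: "{a, b, c, d} \<subseteq> S x" "distinct [a, b, c, d]" "general_position x"
  shows "card (Det x) \<ge> 4"
proof -
  note gp = general_positionD [OF s(3)]
  have mem: "a \<in> S x" "b \<in> S x" "c \<in> S x" "d \<in> S x"
    and ne: "a \<noteq> b" "a \<noteq> c" "a \<noteq> d" "b \<noteq> c" "b \<noteq> d" "c \<noteq> d" using s by auto
  have abc: "dr x a b \<noteq> dr x a c" "dr x a b \<noteq> dr x a d" "dr x a c \<noteq> dr x a d"
    using gp [of b a c] gp [of b a d] gp [of c a d] mem ne by simp_all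
  have not_all: "\<not> (dr x a b = dr x c d \<and> dr x a c = dr x b d \<and> dr x a d = dr x b c)"
  proof
    assume e: "dr x a b = dr x c d \<and> dr x a c = dr x b d \<and> dr x a d = dr x b c"
    show False
      by (rule fano [OF x s(1,2), of "dr x a b" "dr x a c" "dr x a d"])
        (use mem ne x abc e dr [of x a b] dr [of x a c] dr [of x a d] dr [of x c d] dr [of x b d]
          dr [of x b c] in auto)
  qed
  have "\<exists>l. l \<in> Det x \<and> distinct [dr x a b, dr x a c, dr x a d, l]"
  proof (cases "dr x a b = dr x c d")
    case False
    then have "distinct [dr x a b, dr x a c, dr x a d, dr x c d]"
      using abc gp [of a c d] gp [of a d c] mem ne by simp
    then show ?thesis using DetI mem ne by blast
  next
    case ab: True
    show ?thesis
    proof (cases "dr x a c = dr x b d")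
      case False
      then have "distinct [dr x a b, dr x a c, dr x a d, dr x b d]"
        using abc gp [of a b d] gp [of a d b] mem ne by simp
      then show ?thesis using DetI mem ne by blast
    next
      case True
      then have "dr x a d \<noteq> dr x b c" using ab not_all by simp
      then have "distinct [dr x a b, dr x a c, dr x a d, dr x b c]"
        using abc gp [of a b c] gp [of a c b] mem ne by simp
      then show ?thesis using DetI mem ne by blast
    qed
  qed
  then obtain l where l: "l \<in> Det x" "distinct [dr x a b, dr x a c, dr x a d, l]" by blast
  have "length [dr x a b, dr x a c, dr x a d, l] \<le> card (Det x)"
    by (rule card_Det_ge [OF x]) (use l mem ne in \<open>auto intro!: DetI\<close>)
  then show ?thesis by simp
qed

lemma Det_pentagon:
  assumes x: "x \<in> C" and s: "{a, b, c, d, e} \<subseteq> S x" "distinct [a, b, c, d, e]" "general_position x"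
  shows "card (Det x) \<ge> 5"
proof -
  note gp = general_positionD [OF s(3)]
  have mem: "a \<in> S x" "b \<in> S x" "c \<in> S x" "d \<in> S x" "e \<in> S x"
    and ne: "a \<noteq> b" "a \<noteq> c" "a \<noteq> d" "a \<noteq> e" "b \<noteq> c" "b \<noteq> d" "b \<noteq> e" "c \<noteq> d" "c \<noteq> e" "d \<noteq> e"
    using s by auto
  let ?A = "{dr x a b, dr x a c, dr x a d, dr x a e}"
  have dist: "distinct [dr x a b, dr x a c, dr x a d, dr x a e]"
    using gp [of b a c] gp [of b a d] gp [of b a e] gp [of c a d] gp [of c a e] gp [of d a e]
      mem ne by simp
  \<comment> \<open>With only four directions each direction would match the five points in pairs.\<close>
  have "\<not> Det x \<subseteq> ?A"
  proof
    assume sub: "Det x \<subseteq> ?A"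
    have m: "dr x b c \<in> ?A" "dr x b d \<in> ?A"
      "dr x c d \<in> ?A" "dr x c e \<in> ?A" "dr x d e \<in> ?A"
      using sub DetI mem ne by blast+
    \<comment> \<open>A join cannot be parallel to another join through one of its end points, so
      two of the four directions remain possible for each of the joins considered.\<close>
    have bc: "dr x b c = dr x a d \<or> dr x b c = dr x a e"
      using m(1) gp [of a b c] gp [of a c b] mem ne by auto
    have bd: "dr x b d = dr x a c \<or> dr x b d = dr x a e"
      using m(2) gp [of a b d] gp [of a d b] mem ne by auto
    have cd: "dr x c d = dr x a b \<or> dr x c d = dr x a e"
      using m(3) gp [of a c d] gp [of a d c] mem ne by auto
    have ce: "dr x c e = dr x a b \<or> dr x c e = dr x a d"
      using m(4) gp [of a c e] gp [of a e c] mem ne by auto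
    have de: "dr x d e = dr x a b \<or> dr x d e = dr x a c"
      using m(5) gp [of a d e] gp [of a e d] mem ne by auto
    have diff: "dr x b c \<noteq> dr x b d" "dr x b c \<noteq> dr x c d" "dr x b c \<noteq> dr x c e"
      "dr x b d \<noteq> dr x c d" "dr x b d \<noteq> dr x d e" "dr x c d \<noteq> dr x c e" "dr x c d \<noteq> dr x d e"
      "dr x c e \<noteq> dr x d e"
      using gp [of c b d] gp [of b c d] gp [of b c e] gp [of b d c] gp [of b d e] gp [of d c e]
        gp [of c d e] gp [of c e d] mem ne by auto
    show False using bc bd cd ce de diff dist by (elim disjE) simp_all
  qed
  then obtain l where l: "l \<in> Det x" "l \<notin> ?A" by auto
  have "length [l, dr x a b, dr x a c, dr x a d, dr x a e] \<le> card (Det x)"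
    by (rule card_Det_ge [OF x]) (use l dist mem ne in \<open>auto intro!: DetI\<close>)
  then show ?thesis by simp
qed

section \<open>Weights of line classes and the dual plane\<close>

definition weight :: "'d \<Rightarrow> int" where
  "weight l = (\<Sum>x\<in>on l. u x)"

lemma weight_rest: "\<lbrakk>x \<in> C; I x l\<rbrakk> \<Longrightarrow> weight l = u x + rest l x"
  unfolding weight_def rest_def by (rule sum.remove [OF finite_on]) simp

text \<open>\<open>Some (x, j)\<close> stands for the segment \<open>j\<close> of the class
  \<open>x\<close>, \<open>Inl t\<close> for a line \<open>t\<close> of the line class
  \<open>l\<close>, and \<open>Inr y\<close> for the parallel class of segments in
  \<open>y\<close>.\<close>

fun dual_inc :: "'d \<Rightarrow> ('c \<times> int) option \<Rightarrow> 't + 'c \<Rightarrow> bool" where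
  "dual_inc l None (Inl t) = False"
| "dual_inc l None (Inr y) = True"
| "dual_inc l (Some (x, j)) (Inl t) = (val l t x = j)"
| "dual_inc l (Some (x, j)) (Inr y) = (x = y)"

text \<open>The lines of a neighbour class of lines are the points of an affine plane whose lines are the
  segments; the point classes on it are the parallel classes. This is the dual of its projective
  completion, with \<^term>\<open>None\<close> as the line at infinity.\<close>
lemma dual_plane:
  assumes l: "l \<in> D"
  shows "pplane5 (insert None (Some ` (on l \<times> {0..<5}))) (Inl ` T l \<union> Inr ` on l) (dual_inc l)"
    (is "pplane5 ?Q ?L ?inc")
proof
  have finT: "finite (T l)" using finite_T l .
  have fin: "finite (on l)" using finite_on .
  have c6: "card (on l) = 6" using size l .
  have card_Un: "card (Inl ` A \<union> Inr ` B) = card A + card B" if "finite A" "finite B"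
    for A :: "'t set" and B :: "'c set"
    using that by (subst card_Un_disjoint) (auto simp: card_image)
  show "card ?Q = 31" using fin c6 by (subst card_insert_disjoint) (auto simp: card_image card_cartesian_product)
  show "card ?L = 31" using finT fin c6 card_T [OF l] by (simp add: card_Un)
  show "card {k \<in> ?L. ?inc p k} = 6" if p: "p \<in> ?Q" for p
  proof (cases p)
    case None
    then have "{k \<in> ?L. ?inc p k} = Inl ` {} \<union> Inr ` on l" by auto
    then show ?thesis using c6 by (simp add: card_image)
  next
    case (Some q)
    then obtain x j where q: "p = Some (x, j)" "x \<in> on l" "j \<in> {0..<5}" using p by auto
    then have "{k \<in> ?L. ?inc p k} = Inl ` {t \<in> T l. val l t x = j} \<union> Inr ` {x}" by auto
    then show ?thesis using card_pencil [of l x j] l q finT by (simp add: card_Un del: image_insert)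
  qed
  show "card {p \<in> ?Q. ?inc p k} = 6" if k: "k \<in> ?L" for k
  proof (cases k)
    case (Inl t)
    then have "{p \<in> ?Q. ?inc p k} = (\<lambda>x. Some (x, val l t x)) ` on l"
      using val_range [of l t] by auto
    then show ?thesis using c6 by (simp add: card_image inj_on_def)
  next
    case (Inr x)
    then have "x \<in> on l" using k by auto
    then have "{p \<in> ?Q. ?inc p k} = insert None ((\<lambda>j. Some (x, j)) ` {0..<5})"
      using Inr by auto
    moreover have "card (insert None ((\<lambda>j. Some (x, j)) ` {0..<5::int})) = 6"
      by (subst card_insert_disjoint) (auto simp: card_image inj_on_def)
    ultimately show ?thesis by simp
  qed
  show "card {k \<in> ?L. ?inc p k \<and> ?inc q k} = 1" if pq: "p \<in> ?Q" "q \<in> ?Q" "p \<noteq> q" for p q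
  proof -
    have inf: "card {k \<in> ?L. ?inc None k \<and> ?inc (Some (x, j)) k} = 1" if "x \<in> on l" for x j
    proof -
      have "{k \<in> ?L. ?inc None k \<and> ?inc (Some (x, j)) k} = {Inr x}" using that by auto
      then show ?thesis by simp
    qed
    have aff: "card {k \<in> ?L. ?inc (Some (x, j)) k \<and> ?inc (Some (y, i)) k} = 1"
      if x: "x \<in> on l" "j \<in> {0..<5}" and y: "y \<in> on l" "i \<in> {0..<5}" and ne: "(x, j) \<noteq> (y, i)" for x j y i
    proof (cases "x = y")
      case True
      then have "{k \<in> ?L. ?inc (Some (x, j)) k \<and> ?inc (Some (y, i)) k} = {Inr x}" using x ne by auto
      then show ?thesis by simp
    next
      case False
      then have b: "bij_betw (\<lambda>t. val l t y) {t \<in> T l. val l t x = j} {0..<5}"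
        using val_bij [of l x y j] l x y by auto
      then have "i \<in> (\<lambda>t. val l t y) ` {t \<in> T l. val l t x = j}"
        using y by (simp add: bij_betw_def)
      then obtain t where t: "t \<in> T l" "val l t x = j" "val l t y = i" by auto
      have un: "t' = t" if "t' \<in> T l" "val l t' x = j" "val l t' y = i" for t'
        by (rule inj_onD [OF bij_betw_imp_inj_on [OF b]]) (use t that in auto)
      have "{k \<in> ?L. ?inc (Some (x, j)) k \<and> ?inc (Some (y, i)) k} = {Inl t}"
        using False t by (auto dest: un)
      then show ?thesis by simp
    qed
    show ?thesis
    proof (cases p)
      case None
      then show ?thesis using pq inf by auto
    next
      case p: (Some p')
      show ?thesis
      proof (cases q)
        case None
        then show ?thesis using pq p inf by (auto simp: conj_commute)
      next
        case (Some q')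
        have "card {k \<in> ?L. ?inc (Some (fst p', snd p')) k \<and> ?inc (Some (fst q', snd q')) k} = 1"
          by (rule aff) (use pq p Some in \<open>auto simp: prod_eq_iff\<close>)
        then show ?thesis by (simp add: p Some)
      qed
    qed
  qed
  show "card {p \<in> ?Q. ?inc p k \<and> ?inc p k'} = 1" if kk: "k \<in> ?L" "k' \<in> ?L" "k \<noteq> k'" for k k'
  proof -
    have mixed: "card {p \<in> ?Q. ?inc p (Inl t) \<and> ?inc p (Inr x)} = 1" if "x \<in> on l" for t x
    proof -
      have "{p \<in> ?Q. ?inc p (Inl t) \<and> ?inc p (Inr x)} = {Some (x, val l t x)}"
        using that val_range [of l t x] by auto
      then show ?thesis by simp
    qed
    have pts: "card {p \<in> ?Q. ?inc p (Inl t) \<and> ?inc p (Inl t')} = 1"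
      if t: "t \<in> T l" "t' \<in> T l" "t \<noteq> t'" for t t'
    proof -
      obtain x where x: "x \<in> C" "I x l" "val l t x = val l t' x"
        and un: "\<And>y. y \<in> C \<Longrightarrow> I y l \<Longrightarrow> val l t y = val l t' y \<Longrightarrow> y = x"
        using val_meet [OF l t] by blast
      have "{p \<in> ?Q. ?inc p (Inl t) \<and> ?inc p (Inl t')} = {Some (x, val l t x)}"
      proof (intro equalityI subsetI)
        fix p assume p: "p \<in> {p \<in> ?Q. ?inc p (Inl t) \<and> ?inc p (Inl t')}"
        then obtain y j where y: "p = Some (y, j)" "y \<in> on l" by auto
        then have "val l t y = j" "val l t' y = j" using p by auto
        then show "p \<in> {Some (x, val l t x)}" using un [of y] y by auto
      next
        fix p assume "p \<in> {Some (x, val l t x)}"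
        then show "p \<in> {p \<in> ?Q. ?inc p (Inl t) \<and> ?inc p (Inl t')}"
          using x val_range [of l t x] by auto
      qed
      then show ?thesis by simp
    qed
    have inf: "card {p \<in> ?Q. ?inc p (Inr x) \<and> ?inc p (Inr y)} = 1" if "x \<noteq> y" for x y
    proof -
      have "{p \<in> ?Q. ?inc p (Inr x) \<and> ?inc p (Inr y)} = {None}" using that by auto
      then show ?thesis by simp
    qed
    show ?thesis
      using kk mixed pts inf by (cases k; cases k') (auto simp: conj_commute)
  qed
qed

text \<open>With weight 12 or more no segment contains two arc points. The occupied segments are
  then points of the dual plane, at most three on each \<open>Inl t\<close> by the arc property and
  at most three on each \<open>Inr x\<close> because \<open>u x\<close> is at most 3. Twelve of them
  would form a (12,3)-arc.\<close>

lemma weight_le_11: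
  assumes l: "l \<in> D" and small: "\<And>x. x \<in> C \<Longrightarrow> u x \<le> 3"
  shows "weight l \<le> 11"
proof (rule ccontr)
  assume "\<not> weight l \<le> 11"
  then have w: "weight l \<ge> 12" by simp
  \<comment> \<open>At least 12 - 3 = 9 points lie outside \<open>x\<close>, so five times the
    multiplicity is at most 6.\<close>
  have mult01: "mult l x j \<in> {0, 1}" if x: "x \<in> on l" and j: "j \<in> {0..<5}" for x j
  proof -
    have "5 * mult l x j + rest l x \<le> 15" using rest_bound l x j by auto
    moreover have "rest l x \<ge> 9" using weight_rest [of x l] small [of x] x w by auto
    moreover have "mult l x j \<ge> 0" by (simp add: mult_def)
    ultimately show ?thesis by auto
  qed
  define B where "B = {q \<in> on l \<times> {0..<5}. mult l (fst q) (snd q) = 1}"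
  have finB: "finite B" unfolding B_def using finite_on by simp
  have count: "(\<Sum>q\<in>on l \<times> {0..<5}. mult l (fst q) (snd q)) = weight l"
    unfolding weight_def sum_mult [symmetric, of _ l] by (simp add: sum.cartesian_product split_beta)
  have "(\<Sum>q\<in>on l \<times> {0..<5}. mult l (fst q) (snd q)) = (\<Sum>q\<in>on l \<times> {0..<5}. if mult l (fst q) (snd q) = 1 then 1 else 0)"
    by (rule sum.cong) (use mult01 in force)+
  also have "\<dots> = (\<Sum>q\<in>B. 1)"
    unfolding B_def by (rule sum.inter_filter [symmetric]) (use finite_on in auto)
  finally have "card B \<ge> 12" using count w by simp
  then obtain A where A: "A \<subseteq> B" "card A = 12" by (metis obtain_subset_with_card_n)
  have finA: "finite A" using A finB finite_subset by blast
  interpret P: pplane5 "insert None (Some ` (on l \<times> {0..<5}))" "Inl ` T l \<union> Inr ` on l" "dual_inc l"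
    by (rule dual_plane [OF l])
  show False
  proof (rule P.no_12_3_arc [of "Some ` A"])
    show "Some ` A \<subseteq> insert None (Some ` (on l \<times> {0..<5}))" using A by (auto simp: B_def)
    show "card (Some ` A) = 12" using A by (simp add: card_image)
    fix k assume k: "k \<in> Inl ` T l \<union> Inr ` on l"
    have card_le: "card {p \<in> Some ` A. dual_inc l p k} \<le> card {q \<in> B. dual_inc l (Some q) k}"
    proof -
      have "{p \<in> Some ` A. dual_inc l p k} \<subseteq> Some ` {q \<in> B. dual_inc l (Some q) k}" using A by auto
      then have "card {p \<in> Some ` A. dual_inc l p k} \<le> card (Some ` {q \<in> B. dual_inc l (Some q) k})"
        by (rule card_mono [rotated]) (use finB in simp)
      then show ?thesis by (simp add: card_image)
    qed
    show "card {p \<in> Some ` A. dual_inc l p k} \<le> 3"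
    proof (cases k)
      case (Inl t)
      then have t: "t \<in> T l" using k by auto
      let ?X = "{x \<in> on l. mult l x (val l t x) = 1}"
      have "{q \<in> B. dual_inc l (Some q) k} = (\<lambda>x. (x, val l t x)) ` ?X"
        using Inl val_range [of l t] by (auto simp: B_def)
      then have "int (card {q \<in> B. dual_inc l (Some q) k}) = (\<Sum>x\<in>?X. 1)"
        by (simp add: card_image inj_on_def)
      also have "\<dots> = (\<Sum>x\<in>on l. if mult l x (val l t x) = 1 then 1 else 0)"
        by (rule sum.inter_filter [OF finite_on])
      also have "\<dots> = (\<Sum>x\<in>on l. mult l x (val l t x))"
        by (rule sum.cong) (use mult01 val_range in force)+
      also have "\<dots> \<le> 3" using arc_mult l t .
      finally show ?thesis using card_le by linarith
    next
      case (Inr x)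
      then have x: "x \<in> on l" using k by auto
      let ?J = "{j \<in> {0..<5}. mult l x j = 1}"
      have "{q \<in> B. dual_inc l (Some q) k} = (\<lambda>j. (x, j)) ` ?J"
        using Inr x by (auto simp: B_def)
      then have "int (card {q \<in> B. dual_inc l (Some q) k}) = (\<Sum>j\<in>?J. 1)"
        by (simp add: card_image inj_on_def)
      also have "\<dots> = (\<Sum>j\<in>{0..<5}. if mult l x j = 1 then 1 else 0)"
        by (rule sum.inter_filter) simp
      also have "\<dots> = (\<Sum>j\<in>{0..<5}. mult l x j)"
        by (rule sum.cong) (use mult01 x in force)+
      also have "\<dots> \<le> 3" using small x by (simp only: sum_mult) simp
      finally show ?thesis using card_le by linarith
    qed
  qed
qed

section \<open>Successive bounds on the size of a point class\<close>

lemma pigeonhole: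
  assumes "u x > 5 * m"
  obtains j where "j \<in> {0..<5}" "mult l x j > m"
proof -
  have "\<not> (\<forall>j\<in>{0..<5}. mult l x j \<le> m)"
  proof
    assume "\<forall>j\<in>{0..<5}. mult l x j \<le> m"
    then have "(\<Sum>j\<in>{0..<5}. mult l x j) \<le> (\<Sum>j\<in>{0..<5::int}. m)" by (intro sum_mono) auto
    then show False using assms by (simp only: sum_mult) simp
  qed
  then show ?thesis using that by (meson not_le)
qed

lemma rest_pigeonhole:
  assumes l: "l \<in> D" "x \<in> C" "I x l" and u: "u x > 5 * m"
  shows "rest l x \<le> 10 - 5 * m"
proof -
  obtain j where "j \<in> {0..<5}" "mult l x j > m" using pigeonhole u by blast
  then show ?thesis using rest_bound [OF l, of j] by linarith
qed

text \<open>The pigeonhole bound feeds itself. With six points every direction has at most 5 points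
  outside, which forces 44 - 30 = 14 points in the class; then nothing lies outside, so all 44
  points are in it, and a segment has at least four of them.\<close>

lemma u_le_5:
  assumes N: "total = 44" and x: "x \<in> C"
  shows "u x \<le> 5"
proof (rule ccontr)
  assume "\<not> u x \<le> 5"
  then have "u x > 5 * 1" by simp
  then have "rest l x \<le> 5" if "l \<in> through x" for l using rest_pigeonhole [of l x 1] that x by simp
  then have "u x \<ge> 14" using total_bound [OF x, of "{}" 0 5] N by auto
  then have u10: "u x > 5 * 2" by simp
  then have r0: "rest l x \<le> 0" if "l \<in> through x" for l using rest_pigeonhole [of l x 2] that x by simp
  then have "u x \<ge> 44" using total_bound [OF x, of "{}" 0 0] N by auto
  then have u15: "u x > 5 * 3" by simp
  have "card (through x) = 6" using degree [OF x] .
  then have "through x \<noteq> {}" by (metis card.empty zero_neq_numeral)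
  then obtain l where l: "l \<in> through x" by blast
  have "rest l x \<le> -5" using rest_pigeonhole [of l x 3] l x u15 by simp
  then show False using rest_nonneg [of l x] by simp
qed

lemma obtain_distinct_list:
  assumes "u x = int n"
  obtains xs where "distinct xs" "S x = set xs" "length xs = n"
  using assms finite_distinct_list [OF finite_S [of x]] distinct_card unfolding u_def by force

lemma nonempty: "u x > 0 \<Longrightarrow> S x \<noteq> {}"
  by (auto simp: u_def)

lemma triple_or_general:
  assumes "x \<in> C" "\<not> general_position x"
  obtains a b c where "{a, b, c} \<subseteq> S x" "distinct [a, b, c]" "dr x a b = dr x b c"
  using assms unfolding general_position_def by auto

lemma card_Det_ge_4:
  assumes x: "x \<in> C" and u: "u x \<ge> 4"
  shows "card (Det x) \<ge> 4"
proof (cases "general_position x")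
  case True
  obtain xs where xs: "distinct xs" "S x = set xs" "length xs = card (S x)"
    using obtain_distinct_list [of x "card (S x)"] by (auto simp: u_def)
  then have "length xs \<ge> 4" using u by (simp add: u_def)
  then obtain a b c d ys where "xs = a # b # c # d # ys"
    by (auto simp: numeral_eq_Suc Suc_le_length_iff)
  then show ?thesis using xs True by (intro Det_quadrangle [OF x, of a b c d]) auto
next
  case False
  then obtain a b c where abc: "{a, b, c} \<subseteq> S x" "distinct [a, b, c]" "dr x a b = dr x b c"
    using triple_or_general x by blast
  have "\<not> S x \<subseteq> {a, b, c}"
  proof
    assume "S x \<subseteq> {a, b, c}"
    then have "card (S x) \<le> card {a, b, c}" by (rule card_mono [rotated]) simp
    also have "\<dots> \<le> 3" by (simp add: card_insert_if)
    finally show False using u by (simp add: u_def)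
  qed
  then obtain d where "d \<in> S x" "d \<notin> {a, b, c}" by blast
  then show ?thesis using abc by (intro Det_triple [OF x, of a b c d]) auto
qed

lemma u_le_4:
  assumes N: "total = 44" and x: "x \<in> C"
  shows "u x \<le> 4"
proof (rule ccontr)
  assume "\<not> u x \<le> 4"
  then have u: "u x = 5" using u_le_5 [OF N x] by simp
  have ten: "rest l x \<le> 10" if "l \<in> through x" for l
    using that rest_any [OF x _ _ nonempty] u by auto
  show False
  proof (cases "general_position x")
    case True
    obtain xs where xs: "distinct xs" "S x = set xs" "length xs = 5"
      using obtain_distinct_list [of x 5] u by auto
    then obtain a b c d e where "xs = [a, b, c, d, e]"
      by (auto simp: numeral_eq_Suc length_Suc_conv)
    then have "card (Det x) \<ge> 5" using xs True by (intro Det_pentagon [OF x, of a b c d e]) auto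
    \<comment> \<open>With at least five directions the right side is at most 35, whereas 44 - 5 =
      39.\<close>
    moreover have "total - u x \<le> 5 * int (card (Det x)) + 10 * (6 - int (card (Det x)))"
      by (rule total_bound [OF x Det_through [OF x] rest_Det [OF x] ten]) auto
    ultimately show False using N u by simp
  next
    case False
    then obtain a b c where abc: "{a, b, c} \<subseteq> S x" "distinct [a, b, c]" "dr x a b = dr x b c"
      using triple_or_general x by blast
    \<comment> \<open>With at least four directions, one of which has nothing outside
      \<open>x\<close>, the bound is again at most 35.\<close>
    have "total - u x \<le> 5 * (int (card (Det x)) - 1) + 10 * (6 - int (card (Det x)))"
      by (rule total_bound_zero [OF x Det_through [OF x] _ rest_triple [OF x abc] rest_Det [OF x] ten])
        (use abc DetI in auto)
    moreover have "card (Det x) \<ge> 4" using card_Det_ge_4 [OF x] u by simp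
    ultimately show False using N u by simp
  qed
qed

lemma u_le_3:
  assumes N: "total = 44" and x: "x \<in> C"
  shows "u x \<le> 3"
proof (rule ccontr)
  assume "\<not> u x \<le> 3"
  then have u: "u x = 4" using u_le_4 [OF N x] by simp
  have nine: "rest l x \<le> 9" if l: "l \<in> through x" for l
  proof (rule ccontr)
    assume "\<not> rest l x \<le> 9"
    then have "rest l x = 10" using l rest_any [OF x _ _ nonempty, of l] u by auto
    then have w: "weight l = 14" using weight_rest [OF x, of l] l u by simp
    \<comment> \<open>If a line class of weight 14 occurs, each of its nonempty point classes has at
      least 14 - 10 = 4 points, hence exactly 4. But 14 is not a multiple of 4.\<close>
    have "4 dvd u y" if y: "y \<in> on l" for y
    proof (cases "u y > 0")
      case True
      then have "u y \<ge> 4"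
        using y l w weight_rest [of y l] rest_any [of y l] nonempty [of y] by auto
      then have "u y = 4" using u_le_4 [OF N] y by force
      then show ?thesis by simp
    next
      case False
      then have "u y = 0" using u_nonneg [of y] by simp
      then show ?thesis by simp
    qed
    then have "4 dvd weight l" unfolding weight_def by (rule dvd_sum)
    then show False using w by simp
  qed
  \<comment> \<open>At most 5 * 4 + 9 * 2 = 38, whereas 44 - 4 = 40.\<close>
  have "total - u x \<le> 5 * int (card (Det x)) + 9 * (6 - int (card (Det x)))"
    by (rule total_bound [OF x Det_through [OF x] rest_Det [OF x] nine]) auto
  moreover have "card (Det x) \<ge> 4" using card_Det_ge_4 [OF x] u by simp
  ultimately show False using N u by simp
qed

lemma u_le_2:
  assumes N: "total = 44" and x: "x \<in> C"
  shows "u x \<le> 2"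
proof (rule ccontr)
  assume "\<not> u x \<le> 2"
  then have u: "u x = 3" using u_le_3 [OF N x] by simp
  have eight: "rest l x \<le> 8" if l: "l \<in> through x" for l
    using weight_le_11 [of l] u_le_3 [OF N] weight_rest [OF x, of l] l u by simp
  show False
  proof (cases "general_position x")
    case True
    obtain xs where xs: "distinct xs" "S x = set xs" "length xs = 3"
      using obtain_distinct_list [of x 3] u by auto
    then obtain a b c where abc: "xs = [a, b, c]"
      by (auto simp: numeral_eq_Suc length_Suc_conv)
    have "length [dr x a b, dr x b c, dr x a c] \<le> card (Det x)"
      by (rule card_Det_ge [OF x])
        (use xs abc general_positionD [OF True, of a b c] general_positionD [OF True, of b a c]
          general_positionD [OF True, of a c b] in \<open>auto intro!: DetI\<close>)
    \<comment> \<open>At most 5 * 3 + 8 * 3 = 39, whereas 44 - 3 = 41. In the collinear case below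
      the bound is 0 + 8 * 5 = 40.\<close>
    moreover have "total - u x \<le> 5 * int (card (Det x)) + 8 * (6 - int (card (Det x)))"
      by (rule total_bound [OF x Det_through [OF x] rest_Det [OF x] eight]) auto
    ultimately show False using N u by simp
  next
    case False
    then obtain a b c where abc: "{a, b, c} \<subseteq> S x" "distinct [a, b, c]" "dr x a b = dr x b c"
      using triple_or_general x by blast
    have "total - u x \<le> 0 * int (card {dr x a b}) + 8 * (6 - int (card {dr x a b}))"
      by (rule total_bound [OF x _ _ eight])
        (use abc x dr [of x a b] rest_triple [OF x abc] in auto)
    then show False using N u by simp
  qed
qed

text \<open>If two classes determined the same direction, some line of that class would contain a
  two-point segment of each, hence four arc points.\<close>

lemma Det_disjoint:
  assumes x: "x \<in> C" "l \<in> Det x" and y: "y \<in> C" "l \<in> Det y"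
  shows "x = y"
proof (rule ccontr)
  assume ne: "x \<noteq> y"
  have l: "l \<in> D" "I x l" "I y l" using Det_through x y by auto
  have two: "\<exists>j\<in>{0..<5}. mult l z j \<ge> 2" if "z \<in> C" "l \<in> Det z" for z
  proof -
    obtain s s' where s: "s \<in> S z" "s' \<in> S z" "s \<noteq> s'" "l = dr z s s'"
      using \<open>l \<in> Det z\<close> by (auto simp: Det_def)
    have "int (card {s, s'}) \<le> mult l z (seg l z s)"
      by (rule mult_ge) (use s that dr [of z s s'] in auto)
    then show ?thesis using s seg_range [of l z s] by (intro bexI [of _ "seg l z s"]) auto
  qed
  obtain i where i: "i \<in> {0..<5}" "mult l x i \<ge> 2" using two x by blast
  obtain j where j: "j \<in> {0..<5}" "mult l y j \<ge> 2" using two y by blast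
  have "j \<in> (\<lambda>t. val l t y) ` {t \<in> T l. val l t x = i}"
    using val_bij [OF l(1) x(1) y(1) l(2,3) ne i(1)] j by (simp add: bij_betw_def)
  then obtain t where t: "t \<in> T l" "val l t x = i" "val l t y = j" by auto
  have "(\<Sum>z\<in>{x, y}. mult l z (val l t z)) \<le> (\<Sum>z\<in>on l. mult l z (val l t z))"
    by (rule sum_mono2 [OF finite_on]) (use l x y in \<open>auto simp: mult_def\<close>)
  also have "\<dots> \<le> 3" using arc_mult l t by blast
  finally show False using ne t i j by simp
qed

theorem total_neq_44: "total \<noteq> 44"
proof
  assume N: "total = 44"
  have u012: "u x = 0 \<or> u x = 1 \<or> u x = 2" if "x \<in> C" for x
    using u_le_2 [OF N that] u_nonneg [of x] by linarith
  define E where "E = {x \<in> C. u x = 2}"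
  have E: "E \<subseteq> C" "finite E" using finite_points by (auto simp: E_def)
  have cE: "(\<Sum>x\<in>C. if u x = 2 then 1 else 0) = int (card E)"
    unfolding E_def by (simp add: sum.inter_filter [OF finite_points, symmetric])
  have "total \<le> (\<Sum>x\<in>C. 1 + (if u x = 2 then 1 else 0))"
    unfolding total_def by (rule sum_mono) (use u012 in force)
  also have "\<dots> = 31 + int (card E)" using cE by (simp add: sum.distrib card_points)
  finally have E13: "card E \<ge> 13" using N by simp
  have "(\<Sum>x\<in>C. (u x)\<^sup>2) = (\<Sum>x\<in>C. u x + 2 * (if u x = 2 then 1 else 0))"
    by (rule sum.cong) (use u012 in force)+
  also have "\<dots> = 44 + 2 * int (card E)"
    using N cE by (simp add: sum.distrib sum_distrib_left [symmetric] total_def)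
  finally have sq: "(\<Sum>x\<in>C. (u x)\<^sup>2) = 44 + 2 * int (card E)" .
  \<comment> \<open>The summand (w - 10)(w - 11) is never negative on integers. The constant is 44 *
    44 + 5 * 44 - 21 * 264 + 3410 = 22.\<close>
  have "(\<Sum>l\<in>D. (weight l)\<^sup>2 - 21 * weight l + 110)
      = (\<Sum>l\<in>D. (weight l)\<^sup>2) - 21 * (\<Sum>l\<in>D. weight l) + 110 * 31"
    by (simp add: sum.distrib sum_subtractf sum_distrib_left card_lines)
  also have "\<dots> = 22 + 10 * int (card E)"
    unfolding weight_def sum_line_weights sum_line_weights_squared sq
    using N by (simp add: total_def)
  finally have total_sq: "(\<Sum>l\<in>D. (weight l)\<^sup>2 - 21 * weight l + 110) = 22 + 10 * int (card E)" .
  have nonneg: "(weight l)\<^sup>2 - 21 * weight l + 110 \<ge> 0" for l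
  proof -
    have "(weight l - 10) * (weight l - 11) \<ge> 0"
      by (cases "weight l \<le> 10") (auto simp: mult_nonpos_nonpos)
    then show ?thesis by (simp add: power2_eq_square algebra_simps)
  qed
  have "\<exists>l. l \<in> Det x" if "x \<in> E" for x
  proof -
    have "u x = int 2" using that by (simp add: E_def)
    then obtain xs where "distinct xs" "S x = set xs" "length xs = 2"
      using obtain_distinct_list by blast
    then obtain a b where "xs = [a, b]" "a \<noteq> b" "a \<in> S x" "b \<in> S x"
      by (auto simp: numeral_eq_Suc length_Suc_conv)
    then show ?thesis using DetI by blast
  qed
  then obtain h where h: "\<And>x. x \<in> E \<Longrightarrow> h x \<in> Det x" by metis
  have inj: "inj_on h E"
    by (rule inj_onI) (use Det_disjoint h E in \<open>metis subsetD\<close>)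
  have hD: "h ` E \<subseteq> D" using h E Det_through by blast
  have "12 \<le> (weight l)\<^sup>2 - 21 * weight l + 110" if l: "l \<in> h ` E" for l
  proof -
    obtain x where x: "x \<in> E" "l = h x" using l by auto
    then have xC: "x \<in> C" "l \<in> Det x" "u x = 2" using h by (auto simp: E_def)
    then have "weight l \<le> 7" using weight_rest [of x l] rest_Det [of x l] Det_through [of x] by auto
    \<comment> \<open>This product equals (w - 10)(w - 11) - 12.\<close>
    then have "(weight l - 7) * (weight l - 14) \<ge> 0" by (intro mult_nonpos_nonpos) auto
    then show ?thesis by (simp add: power2_eq_square algebra_simps)
  qed
  then have "(\<Sum>l\<in>h ` E. 12) \<le> (\<Sum>l\<in>h ` E. (weight l)\<^sup>2 - 21 * weight l + 110)"
    by (rule sum_mono)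
  also have "\<dots> \<le> (\<Sum>l\<in>D. (weight l)\<^sup>2 - 21 * weight l + 110)"
    by (rule sum_mono2 [OF finite_lines hD]) (rule nonneg)
  finally show False using inj E13 total_sq by (simp add: card_image)
qed

end

section \<open>Coordinates\<close>

text \<open>A point is written as \<open>x + \<pi> s\<close> and a linear form as \<open>l + \<pi> t\<close>, where \<open>\<pi>\<close> generates the radical and
  all entries are base 5 digits, except that the first nonzero entry of \<open>x\<close> is 1 and that of \<open>l\<close> is -1,
  with a zero of \<open>s\<close> or \<open>t\<close> at this position. The sign solves the equation of the line for its pivot
  coordinate.\<close>
type_synonym triple = "int \<times> int \<times> int"

fun dot :: "triple \<Rightarrow> triple \<Rightarrow> int" where
  "dot (a, b, c) (x, y, z) = a * x + b * y + c * z"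

fun pivot :: "triple \<Rightarrow> triple \<Rightarrow> int" where
  "pivot (x, y, z) (a, b, c) = (if x \<noteq> 0 then a else if y \<noteq> 0 then b else c)"

definition digits :: "int list" where
  "digits = [0, 1, 2, 3, 4]"

text \<open>Lists rather than sets make the finite checks on PG(2,5) executable.\<close>

definition class_list :: "triple list" where
  "class_list = List.product [1] (List.product digits digits)
    @ List.product [0] (List.product [1] digits) @ [(0, 0, 1)]"

definition line_list :: "triple list" where
  "line_list = List.product [-1] (List.product digits digits)
    @ List.product [0] (List.product [-1] digits) @ [(0, 0, -1)]"

definition offset_list :: "triple \<Rightarrow> triple list" where
  "offset_list x = filter (\<lambda>s. pivot x s = 0) (List.product digits (List.product digits digits))"

definition incident :: "triple \<Rightarrow> triple \<Rightarrow> bool" where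
  "incident x l \<longleftrightarrow> dot l x mod 5 = 0"

definition classes :: "triple set" where
  "classes = set class_list"

definition line_classes :: "triple set" where
  "line_classes = set line_list"

definition offsets :: "triple \<Rightarrow> triple set" where
  "offsets x = set (offset_list x)"

section \<open>Incidences of PG(2,5) by enumeration\<close>

lemma distinct_lists:
  "distinct class_list \<and> distinct line_list \<and> length class_list = 31 \<and> length line_list = 31"
  by code_simp

lemma degree_check: "\<forall>x\<in>set class_list. length (filter (incident x) line_list) = 6"
  by code_simp

lemma size_check: "\<forall>l\<in>set line_list. length (filter (\<lambda>x. incident x l) class_list) = 6"
  by code_simp

lemma join_check: "\<forall>x\<in>set class_list. \<forall>y\<in>set class_list. x \<noteq> y \<longrightarrow>
    length (filter (incident y) (filter (incident x) line_list)) = 1"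
  by code_simp

lemma meet_check: "\<forall>l\<in>set line_list. \<forall>k\<in>set line_list. l \<noteq> k \<longrightarrow>
    length (filter (\<lambda>x. incident x k) (filter (\<lambda>x. incident x l) class_list)) = 1"
  by code_simp

lemma class_offset_check: "\<forall>x\<in>set class_list. \<forall>s\<in>set (offset_list x). s \<noteq> (0, 0, 0) \<longrightarrow>
    length (filter (incident s) (filter (incident x) line_list)) = 1"
  by code_simp

lemma line_offset_check: "\<forall>l\<in>set line_list. \<forall>t\<in>set (offset_list l). t \<noteq> (0, 0, 0) \<longrightarrow>
    length (filter (\<lambda>x. incident x t) (filter (\<lambda>x. incident x l) class_list)) = 1"
  by code_simp

lemma card_offset_check:
  "\<forall>l\<in>set line_list. distinct (offset_list l) \<and> length (offset_list l) = 25"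
  by code_simp

lemma card_filter: "distinct xs \<Longrightarrow> card {x \<in> set xs. P x} = length (filter P xs)"
  by (metis distinct_card distinct_filter set_filter)

interpretation pg: pplane5 classes line_classes incident
proof
  show "card classes = 31" "card line_classes = 31"
    using distinct_lists distinct_card unfolding classes_def line_classes_def by metis+
  show "card {l \<in> line_classes. incident p l} = 6" if "p \<in> classes" for p
    using that degree_check distinct_lists by (simp add: card_filter classes_def line_classes_def)
  show "card {p \<in> classes. incident p l} = 6" if "l \<in> line_classes" for l
    using that size_check distinct_lists by (simp add: card_filter classes_def line_classes_def)
  show "card {l \<in> line_classes. incident p l \<and> incident q l} = 1"
    if "p \<in> classes" "q \<in> classes" "p \<noteq> q" for p q
    using that join_check distinct_lists
    by (simp add: card_filter classes_def line_classes_def)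
  show "card {p \<in> classes. incident p l \<and> incident p k} = 1"
    if "l \<in> line_classes" "k \<in> line_classes" "l \<noteq> k" for l k
    using that meet_check distinct_lists
    by (simp add: card_filter classes_def line_classes_def)
qed

lemma card_1_ex1: "card {x \<in> A. P x} = 1 \<Longrightarrow> \<exists>!x. x \<in> A \<and> P x"
  by (metis (no_types, lifting) One_nat_def card_1_singleton_iff mem_Collect_eq singleton_iff)

text \<open>A nonzero offset vanishes at the pivot of \<open>x\<close>, so it is not a multiple of
  \<open>x\<close>; the two vectors span a line of PG(2,5).\<close>

lemma class_offset:
  assumes "x \<in> classes" "s \<in> offsets x" "s \<noteq> (0, 0, 0)"
  shows "\<exists>!l. l \<in> line_classes \<and> incident x l \<and> incident s l"
proof (rule card_1_ex1)
  show "card {l \<in> line_classes. incident x l \<and> incident s l} = 1"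
    using assms class_offset_check distinct_lists
    by (simp add: card_filter classes_def line_classes_def offsets_def)
qed

lemma line_offset:
  assumes "l \<in> line_classes" "t \<in> offsets l" "t \<noteq> (0, 0, 0)"
  shows "\<exists>!x. x \<in> classes \<and> incident x l \<and> incident x t"
proof (rule card_1_ex1)
  show "card {x \<in> classes. incident x l \<and> incident x t} = 1"
    using assms line_offset_check distinct_lists
    by (simp add: card_filter classes_def line_classes_def offsets_def)
qed

lemma card_offsets: "l \<in> line_classes \<Longrightarrow> card (offsets l) = 25"
  using card_offset_check distinct_card unfolding line_classes_def offsets_def by metis

section \<open>Linear combinations of offsets modulo 5\<close>

lemma set_digits: "set digits = {0..<5}"
  by (auto simp: digits_def)

lemma mem_offsets:
  "(a, b, c) \<in> offsets x \<longleftrightarrow> a \<in> {0..<5} \<and> b \<in> {0..<5} \<and> c \<in> {0..<5} \<and> pivot x (a, b, c) = 0"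
  by (auto simp: offsets_def offset_list_def set_digits)

text \<open>Four terms accommodate the combination \<open>a + b - c - d\<close>. A difference of two
  offsets is obtained with coefficients 0 on two filler arguments.\<close>

fun combine :: "int \<Rightarrow> int \<Rightarrow> int \<Rightarrow> int \<Rightarrow> triple \<Rightarrow> triple \<Rightarrow> triple \<Rightarrow> triple \<Rightarrow> triple" where
  "combine i j k m (a, b, c) (a', b', c') (d, e, f) (d', e', f') =
    ((i * a + j * a' + k * d + m * d') mod 5, (i * b + j * b' + k * e + m * e') mod 5,
      (i * c + j * c' + k * f + m * f') mod 5)"

lemma combine_offsets:
  "\<lbrakk>s \<in> offsets x; s' \<in> offsets x; r \<in> offsets x; r' \<in> offsets x\<rbrakk>
    \<Longrightarrow> combine i j k m s s' r r' \<in> offsets x"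
  by (cases s; cases s'; cases r; cases r'; cases x) (auto simp: mem_offsets split: if_splits)

lemma dot_combine:
  "dot l (combine i j k m s s' r r') mod 5
    = (i * dot l s + j * dot l s' + k * dot l r + m * dot l r') mod 5"
proof -
  obtain l1 l2 l3 where l: "l = (l1, l2, l3)" by (cases l)
  obtain a b c where s: "s = (a, b, c)" by (cases s)
  obtain a' b' c' where s': "s' = (a', b', c')" by (cases s')
  obtain d e f where r: "r = (d, e, f)" by (cases r)
  obtain d' e' f' where r': "r' = (d', e', f')" by (cases r')
  have red: "(l1 * (p mod 5) + l2 * (q mod 5) + l3 * (w mod 5)) mod 5 = (l1 * p + l2 * q + l3 * w) mod 5"
    for p q w :: int
    by (intro mod_add_cong mod_mult_cong) auto
  have "dot l (combine i j k m s s' r r') mod 5 =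
    (l1 * (i * a + j * a' + k * d + m * d') + l2 * (i * b + j * b' + k * e + m * e')
      + l3 * (i * c + j * c' + k * f + m * f')) mod 5"
    by (simp only: l s s' r r' combine.simps dot.simps red)
  also have "\<dots> = (i * dot l s + j * dot l s' + k * dot l r + m * dot l r') mod 5"
    by (simp add: l s s' r r' algebra_simps)
  finally show ?thesis .
qed

lemma dot_commute: "dot x y = dot y x"
  by (cases x; cases y) simp

lemma combine_diff_zero:
  assumes "s \<in> offsets x" "s' \<in> offsets x" "combine 1 (-1) 0 0 s s' s s = (0, 0, 0)"
  shows "s = s'"
proof -
  have *: "a = b" if "a \<in> {0..<5}" "b \<in> {0..<5}" "(a - b) mod 5 = 0" for a b :: int
    using that by (simp, presburger)
  obtain a b c a' b' c' where "s = (a, b, c)" "s' = (a', b', c')" by (cases s; cases s')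
  then show ?thesis using assms *[of a a'] *[of b b'] *[of c c'] by (simp add: mem_offsets)
qed

lemma combine_fano:
  assumes "a \<in> offsets x" "b \<in> offsets x" "c \<in> offsets x" "d \<in> offsets x"
    and "combine 1 1 (-1) (-1) a b c d = (0, 0, 0)" "combine 1 (-1) 1 (-1) a b c d = (0, 0, 0)"
  shows "b = c"
proof -
  have *: "j = k" if "j \<in> {0..<5}" "k \<in> {0..<5}"
    "(i + j - k - m) mod 5 = 0" "(i - j + k - m) mod 5 = 0" for i j k m :: int
  proof -
    \<comment> \<open>The difference of the two congruences is 2 (j - k), and 2 is invertible modulo
      5.\<close>
    have "5 dvd (i + j - k - m) - (i - j + k - m)"
      using that(3,4) dvd_diff [of 5 "i + j - k - m" "i - j + k - m"] by (simp only: mod_eq_0_iff_dvd)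
    then have "5 dvd 2 * (j - k)" by (simp add: algebra_simps)
    then show ?thesis using that(1,2) by simp presburger
  qed
  obtain a1 a2 a3 b1 b2 b3 c1 c2 c3 d1 d2 d3
    where "a = (a1, a2, a3)" "b = (b1, b2, b3)" "c = (c1, c2, c3)" "d = (d1, d2, d3)"
    by (cases a; cases b; cases c; cases d)
  then show ?thesis using assms *[of b1 c1 a1 d1] *[of b2 c2 a2 d2] *[of b3 c3 a3 d3]
    by (simp add: mem_offsets)
qed

section \<open>Segments and lines in coordinates\<close>

definition level :: "triple \<Rightarrow> triple \<Rightarrow> triple \<Rightarrow> int" where
  "level l t x = (- dot t x) mod 5"

lemma level_eq_iff: "level l t x = level l t' x \<longleftrightarrow> incident x (combine 1 (-1) 0 0 t t' t t)"
proof -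
  have "dot (combine 1 (-1) 0 0 t t' t t) x mod 5 = (dot t x - dot t' x) mod 5"
    using dot_combine [of x 1 "-1" 0 0 t t' t t] by (simp add: dot_commute [of x])
  moreover have "(- a) mod 5 = (- b) mod 5 \<longleftrightarrow> (a - b) mod 5 = 0" for a b :: int by presburger
  ultimately show ?thesis by (simp add: incident_def level_def)
qed

text \<open>The difference \<open>t - t'\<close> is a nonzero offset of \<open>l\<close>, so the two
  forms \<open>l\<close> and \<open>t - t'\<close> have exactly one common zero in PG(2,5).\<close>

lemma level_meet:
  assumes "l \<in> line_classes" "t \<in> offsets l" "t' \<in> offsets l" "t \<noteq> t'"
  shows "\<exists>!x. x \<in> classes \<and> incident x l \<and> level l t x = level l t' x"
  unfolding level_eq_iff
  by (rule line_offset) (use assms combine_offsets combine_diff_zero in blast)+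

text \<open>By \<open>level_meet\<close> the pair of levels at \<open>x\<close> and \<open>y\<close>
  determines \<open>t\<close>. There are 25 offsets and 25 pairs, so every pair occurs.\<close>

lemma level_bij:
  assumes l: "l \<in> line_classes" and x: "x \<in> classes" and y: "y \<in> classes"
    and on: "incident x l" "incident y l" and ne: "x \<noteq> y" and j: "j \<in> {0..<5}"
  shows "bij_betw (\<lambda>t. level l t y) {t \<in> offsets l. level l t x = j} {0..<5}"
proof -
  let ?h = "\<lambda>t. (level l t x, level l t y)"
  have inj: "inj_on ?h (offsets l)"
  proof (rule inj_onI, rule ccontr)
    fix t t' assume t: "t \<in> offsets l" "t' \<in> offsets l" "?h t = ?h t'" "t \<noteq> t'"
    then show False using level_meet [OF l t(1,2,4)] x y on ne by blast
  qed
  have "?h ` offsets l \<subseteq> {0..<5} \<times> {0..<5}" by (auto simp: level_def)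
  moreover have "card (?h ` offsets l) = card ({0..<5::int} \<times> {0..<5::int})"
    using card_image [OF inj] card_offsets [OF l] by (simp add: card_cartesian_product)
  ultimately have img: "?h ` offsets l = {0..<5} \<times> {0..<5}"
    by (intro card_subset_eq) auto
  show ?thesis unfolding bij_betw_def
  proof
    show "inj_on (\<lambda>t. level l t y) {t \<in> offsets l. level l t x = j}"
      using inj by (auto simp: inj_on_def)
    show "(\<lambda>t. level l t y) ` {t \<in> offsets l. level l t x = j} = {0..<5}"
    proof
      show "(\<lambda>t. level l t y) ` {t \<in> offsets l. level l t x = j} \<subseteq> {0..<5}"
        by (auto simp: level_def)
      show "{0..<5} \<subseteq> (\<lambda>t. level l t y) ` {t \<in> offsets l. level l t x = j}"
      proof
        fix i :: int assume "i \<in> {0..<5}"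
        then have "(j, i) \<in> ?h ` offsets l" using j by (simp add: img)
        then show "i \<in> (\<lambda>t. level l t y) ` {t \<in> offsets l. level l t x = j}" by auto
      qed
    qed
  qed
qed

text \<open>The form \<open>l + \<pi> t\<close> at the point \<open>x + \<pi> s\<close> has the
  value \<pi> times carry + t x + l s when the classes are incident. \<open>segment\<close> collects
  the terms without \<open>t\<close>, and \<open>level\<close> is the negative of the remaining one,
  so that incidence becomes equality of the two.\<close>

definition segment :: "(triple \<Rightarrow> triple \<Rightarrow> int) \<Rightarrow> triple \<Rightarrow> triple \<Rightarrow> triple \<Rightarrow> int" where
  "segment carry l x s = (carry l x + dot l s) mod 5"

lemma segment_eq_iff:
  "segment carry l x s = segment carry l x s' \<longleftrightarrow> (dot l s - dot l s') mod 5 = 0"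
  unfolding segment_def by presburger

lemma segment_eq_level_iff:
  "segment carry l x s = level l t x \<longleftrightarrow> (carry l x + dot t x + dot l s) mod 5 = 0"
proof -
  have "a mod 5 = (- b) mod 5 \<longleftrightarrow> (a + b) mod 5 = 0" for a b :: int by presburger
  from this [of "carry l x + dot l s" "dot t x"] show ?thesis
    by (simp add: segment_def level_def ac_simps)
qed

lemma segment_direction:
  assumes "x \<in> classes" "s \<in> offsets x" "s' \<in> offsets x" "s \<noteq> s'"
  shows "\<exists>!l. l \<in> line_classes \<and> incident x l \<and> segment carry l x s = segment carry l x s'"
proof -
  have "\<exists>!l. l \<in> line_classes \<and> incident x l \<and> incident (combine 1 (-1) 0 0 s s' s s) l"
    by (rule class_offset) (use assms combine_offsets combine_diff_zero in blast)+
  then show ?thesis by (simp add: incident_def dot_combine segment_eq_iff)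
qed

text \<open>The vector \<open>a + b - c - d\<close> is killed by the distinct forms \<open>l\<^sub>2\<close> and \<open>l\<^sub>3\<close>, and \<open>a - b + c - d\<close> by \<open>l\<^sub>1\<close>
  and \<open>l\<^sub>3\<close>, so both vanish and \<open>2 * (b - c) = 0\<close>.\<close>
lemma segment_fano:
  assumes x: "x \<in> classes" and abcd: "{a, b, c, d} \<subseteq> offsets x" "distinct [a, b, c, d]"
    and l: "l\<^sub>1 \<in> line_classes" "l\<^sub>2 \<in> line_classes" "l\<^sub>3 \<in> line_classes"
      "incident x l\<^sub>1" "incident x l\<^sub>2" "incident x l\<^sub>3" "distinct [l\<^sub>1, l\<^sub>2, l\<^sub>3]"
    and s1: "segment w l\<^sub>1 x a = segment w l\<^sub>1 x b" "segment w l\<^sub>1 x c = segment w l\<^sub>1 x d"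
    and s2: "segment w l\<^sub>2 x a = segment w l\<^sub>2 x c" "segment w l\<^sub>2 x b = segment w l\<^sub>2 x d"
    and s3: "segment w l\<^sub>3 x a = segment w l\<^sub>3 x d" "segment w l\<^sub>3 x b = segment w l\<^sub>3 x c"
  shows False
proof -
  have mem: "a \<in> offsets x" "b \<in> offsets x" "c \<in> offsets x" "d \<in> offsets x" using abcd by auto
  have ne: "l\<^sub>1 \<noteq> l\<^sub>3" "l\<^sub>2 \<noteq> l\<^sub>3" using l by auto
  have add0: "(p + q) mod 5 = 0" if "p mod 5 = 0" "q mod 5 = 0" for p q :: int
    using that by presburger
  have neg0: "(q - p) mod 5 = 0" if "(p - q) mod 5 = 0" for p q :: int using that by presburger
  note seg = segment_eq_iff
  have e2: "incident (combine 1 1 (-1) (-1) a b c d) l\<^sub>2"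
    using add0 [OF s2 [unfolded seg]] by (simp add: incident_def dot_combine algebra_simps)
  have e3: "incident (combine 1 1 (-1) (-1) a b c d) l\<^sub>3"
    using add0 [OF s3 [unfolded seg]] by (simp add: incident_def dot_combine algebra_simps)
  have f1: "incident (combine 1 (-1) 1 (-1) a b c d) l\<^sub>1"
    using add0 [OF s1 [unfolded seg]] by (simp add: incident_def dot_combine algebra_simps)
  have f3: "incident (combine 1 (-1) 1 (-1) a b c d) l\<^sub>3"
    using add0 [OF s3(1) [unfolded seg] neg0 [OF s3(2) [unfolded seg]]]
    by (simp add: incident_def dot_combine algebra_simps)
  have "combine 1 1 (-1) (-1) a b c d = (0, 0, 0)"
    using class_offset [OF x combine_offsets [OF mem], of 1 1 "-1" "-1"] e2 e3 l ne by blast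
  moreover have "combine 1 (-1) 1 (-1) a b c d = (0, 0, 0)"
    using class_offset [OF x combine_offsets [OF mem], of 1 "-1" 1 "-1"] f1 f3 l ne by blast
  ultimately have "b = c" by (rule combine_fano [OF mem])
  then show False using abcd by simp
qed

text \<open>The carry only shifts the numbering of the segments of \<open>x\<close> in a given
  direction, so it can be left arbitrary and one argument serves both rings.\<close>

theorem arc_card_neq_44:
  fixes V :: "(triple \<times> triple) set" and carry :: "triple \<Rightarrow> triple \<Rightarrow> int"
  assumes V: "V \<subseteq> Sigma classes offsets"
    and arc: "\<And>l t. l \<in> line_classes \<Longrightarrow> t \<in> offsets l \<Longrightarrow>
      card {(x, s) \<in> V. incident x l \<and> (carry l x + dot t x + dot l s) mod 5 = 0} \<le> 3"
  shows "card V \<noteq> 44"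
proof -
  define S where "S x = {s. (x, s) \<in> V}" for x
  have S_sub: "S x \<subseteq> offsets x" for x using V by (auto simp: S_def)
  have finS: "finite (S x)" for x
    by (rule finite_subset [OF S_sub]) (simp add: offsets_def)
  have fin: "finite classes" by (simp add: classes_def)
  have V_eq: "V = Sigma classes S" using V by (auto simp: S_def)
  interpret hj_arc classes line_classes incident S "segment carry" offsets level
  proof
    show "finite (S x)" for x by (rule finS)
    show "segment carry l x s \<in> {0..<5}" for l x s by (simp add: segment_def)
    show "level l t x \<in> {0..<5}" for l t x by (simp add: level_def)
    show "card (offsets l) = 25" if "l \<in> line_classes" for l using card_offsets that .
    show "(\<Sum>x\<in>{x \<in> classes. incident x l}. card {s \<in> S x. segment carry l x s = level l t x}) \<le> 3"
      if l: "l \<in> line_classes" "t \<in> offsets l" for l t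
    proof -
      have iff: "segment carry l x s = level l t x \<longleftrightarrow> (carry l x + dot t x + dot l s) mod 5 = 0"
        for x s by (rule segment_eq_level_iff)
      have "{(x, s) \<in> V. incident x l \<and> (carry l x + dot t x + dot l s) mod 5 = 0}
          = Sigma {x \<in> classes. incident x l} (\<lambda>x. {s \<in> S x. segment carry l x s = level l t x})"
        unfolding iff by (auto simp: V_eq)
      then show ?thesis using arc [OF l] fin finS by simp
    qed
  next
    fix l x y j assume "l \<in> line_classes" "x \<in> classes" "y \<in> classes" "incident x l" "incident y l"
      "x \<noteq> y" "j \<in> {0..<5::int}"
    then show "bij_betw (\<lambda>t. level l t y) {t \<in> offsets l. level l t x = j} {0..<5}"
      by (rule level_bij)
  next
    fix l t t' assume "l \<in> line_classes" "t \<in> offsets l" "t' \<in> offsets l" "t \<noteq> t'"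
    then show "\<exists>!x. x \<in> classes \<and> incident x l \<and> level l t x = level l t' x" by (rule level_meet)
  next
    fix x s s' assume "x \<in> classes" "s \<in> S x" "s' \<in> S x" "s \<noteq> s'"
    then show "\<exists>!l. l \<in> line_classes \<and> incident x l \<and> segment carry l x s = segment carry l x s'"
      using S_sub [of x] by (intro segment_direction) auto
  next
    fix x a b c d l\<^sub>1 l\<^sub>2 l\<^sub>3
    assume "x \<in> classes" "{a, b, c, d} \<subseteq> S x" "distinct [a, b, c, d]"
      "l\<^sub>1 \<in> line_classes" "l\<^sub>2 \<in> line_classes" "l\<^sub>3 \<in> line_classes"
      "incident x l\<^sub>1" "incident x l\<^sub>2" "incident x l\<^sub>3" "distinct [l\<^sub>1, l\<^sub>2, l\<^sub>3]"
      "segment carry l\<^sub>1 x a = segment carry l\<^sub>1 x b" "segment carry l\<^sub>1 x c = segment carry l\<^sub>1 x d"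
      "segment carry l\<^sub>2 x a = segment carry l\<^sub>2 x c" "segment carry l\<^sub>2 x b = segment carry l\<^sub>2 x d"
      "segment carry l\<^sub>3 x a = segment carry l\<^sub>3 x d" "segment carry l\<^sub>3 x b = segment carry l\<^sub>3 x c"
    then show False by (intro segment_fano [OF _ subset_trans [OF _ S_sub]])
  qed
  have "int (card V) = total"
    unfolding V_eq total_def u_def using fin finS by simp
  then show ?thesis using total_neq_44 by auto
qed

section \<open>The rings\<close>

lemma classes_cases:
  assumes "x \<in> classes"
  obtains y z where "x = (1, y, z)" "y \<in> {0..<5}" "z \<in> {0..<5}"
  | z where "x = (0, 1, z)" "z \<in> {0..<5}"
  | "x = (0, 0, 1)"
  using assms by (auto simp: classes_def class_list_def set_digits)

lemma line_classes_cases: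
  assumes "l \<in> line_classes"
  obtains y z where "l = (-1, y, z)" "y \<in> {0..<5}" "z \<in> {0..<5}"
  | z where "l = (0, -1, z)" "z \<in> {0..<5}"
  | "l = (0, 0, -1)"
  using assms by (auto simp: line_classes_def line_list_def set_digits)

lemma classesI:
  "\<lbrakk>y \<in> {0..<5}; z \<in> {0..<5}\<rbrakk> \<Longrightarrow> (1, y, z) \<in> classes"
  "z \<in> {0..<5} \<Longrightarrow> (0, 1, z) \<in> classes"
  "(0, 0, 1) \<in> classes"
  by (auto simp: classes_def class_list_def set_digits)

text \<open>A ring of order 25 whose elements are written with two base 5 digits, the second digit spanning
  the radical. In \<open>digit_linear\<close> the function \<open>carry\<close> records how sums of products of first digits
  spill over into the second digit: it is division by 5 for \<open>Z25\<close> and zero for \<open>S5\<close>.\<close>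
locale digit_ring =
  fixes R :: "'a fring" and em :: "int \<Rightarrow> int \<Rightarrow> 'a" and carry :: "int \<Rightarrow> int"
  assumes em_closed: "\<lbrakk>a \<in> {0..<5}; b \<in> {0..<5}\<rbrakk> \<Longrightarrow> em a b \<in> rcar R"
    and em_surj: "r \<in> rcar R \<Longrightarrow> \<exists>a\<in>{0..<5}. \<exists>b\<in>{0..<5}. r = em a b"
    and radical_nonzero: "em 0 1 \<noteq> em 0 0"
    and add_closed: "\<lbrakk>p \<in> rcar R; q \<in> rcar R\<rbrakk> \<Longrightarrow> radd R p q \<in> rcar R"
    and mul_closed: "\<lbrakk>p \<in> rcar R; q \<in> rcar R\<rbrakk> \<Longrightarrow> rmul R p q \<in> rcar R"
    and zero_mul: "r \<in> rcar R \<Longrightarrow> rmul R (em 0 0) r = em 0 0"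
    and mul_zero: "r \<in> rcar R \<Longrightarrow> rmul R r (em 0 0) = em 0 0"
    and one_mul: "r \<in> rcar R \<Longrightarrow> rmul R (em 1 0) r = r"
    and zero_add: "r \<in> rcar R \<Longrightarrow> radd R (em 0 0) r = r"
    and add_zero: "r \<in> rcar R \<Longrightarrow> radd R r (em 0 0) = r"
    and mul_assoc: "\<lbrakk>p \<in> rcar R; q \<in> rcar R; r \<in> rcar R\<rbrakk>
      \<Longrightarrow> rmul R (rmul R p q) r = rmul R p (rmul R q r)"
    and distrib: "\<lbrakk>p \<in> rcar R; q \<in> rcar R; r \<in> rcar R\<rbrakk>
      \<Longrightarrow> rmul R (radd R p q) r = radd R (rmul R p r) (rmul R q r)"
    and unit: "\<lbrakk>a \<in> {1..<5}; b \<in> {0..<5}\<rbrakk>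
      \<Longrightarrow> \<exists>w\<in>rcar R. rmul R (em a b) w = em 1 0 \<and> rmul R w (em a b) = em 1 0"
    and radical_mul: "\<lbrakk>b \<in> {0..<5}; w \<in> rcar R\<rbrakk> \<Longrightarrow> \<exists>b'\<in>{0..<5}. rmul R (em 0 b) w = em 0 b'"
    and radical_square: "b \<in> {0..<5} \<Longrightarrow> rmul R (em 0 b) (em 0 1) = em 0 0"
    and digit_linear: "\<lbrakk>{x\<^sub>1, x\<^sub>2, x\<^sub>3, s\<^sub>1, s\<^sub>2, s\<^sub>3, l\<^sub>2, l\<^sub>3, t\<^sub>2, t\<^sub>3} \<subseteq> {0..<5};
      (l\<^sub>2 * x\<^sub>2 + l\<^sub>3 * x\<^sub>3 - x\<^sub>1) mod 5 = 0;
      (carry (l\<^sub>2 * x\<^sub>2 + l\<^sub>3 * x\<^sub>3 - x\<^sub>1) + t\<^sub>2 * x\<^sub>2 + t\<^sub>3 * x\<^sub>3 + l\<^sub>2 * s\<^sub>2 + l\<^sub>3 * s\<^sub>3 - s\<^sub>1) mod 5 = 0\<rbrakk>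
      \<Longrightarrow> em x\<^sub>1 s\<^sub>1 = radd R (rmul R (em l\<^sub>2 t\<^sub>2) (em x\<^sub>2 s\<^sub>2)) (rmul R (em l\<^sub>3 t\<^sub>3) (em x\<^sub>3 s\<^sub>3))"
begin

section \<open>Normal forms of points\<close>

lemma zero_closed: "em 0 0 \<in> rcar R" and one_closed: "em 1 0 \<in> rcar R" and radical_closed: "em 0 1 \<in> rcar R"
  by (simp_all add: em_closed)

fun emb :: "triple \<times> triple \<Rightarrow> 'a \<times> 'a \<times> 'a" where
  "emb ((x\<^sub>1, x\<^sub>2, x\<^sub>3), (s\<^sub>1, s\<^sub>2, s\<^sub>3)) = (em x\<^sub>1 s\<^sub>1, em x\<^sub>2 s\<^sub>2, em x\<^sub>3 s\<^sub>3)"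

definition rspan :: "'a \<times> 'a \<times> 'a \<Rightarrow> ('a \<times> 'a \<times> 'a) set" where
  "rspan v = smul R v ` rcar R"

text \<open>Multiplication by a unit permutes the scalars.\<close>

lemma rspan_unit:
  assumes v: "v \<in> vecs R" and w: "w \<in> rcar R" "w' \<in> rcar R" "rmul R w w' = em 1 0"
  shows "rspan (smul R v w) = rspan v"
proof -
  have assoc: "smul R (smul R v w) r = smul R v (rmul R w r)" if "r \<in> rcar R" for r
    using v w that by (auto simp: smul_def vecs_def mul_assoc)
  have "rspan (smul R v w) = smul R v ` (rmul R w ` rcar R)"
    unfolding rspan_def image_image by (rule image_cong) (simp_all add: assoc)
  moreover have "rmul R w ` rcar R = rcar R"
  proof
    show "rmul R w ` rcar R \<subseteq> rcar R" using w mul_closed by auto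
    show "rcar R \<subseteq> rmul R w ` rcar R"
    proof
      fix r assume r: "r \<in> rcar R"
      then have "r = rmul R w (rmul R w' r)" using w mul_assoc [of w w' r] one_mul by simp
      then show "r \<in> rmul R w ` rcar R" using r w mul_closed by blast
    qed
  qed
  ultimately show ?thesis by (simp add: rspan_def)
qed

text \<open>The first unit coordinate of a generator is scaled to 1. The coordinates before it lie
  in the radical and stay there.\<close>

lemma normal_form:
  assumes "free_rank1 R M"
  shows "\<exists>p \<in> Sigma classes offsets. M = rspan (emb p)"
proof -
  obtain v where v: "v \<in> vecs R" "inj_on (smul R v) (rcar R)" "M = rspan v"
    using assms by (auto simp: free_rank1_def rspan_def)
  obtain v1 v2 v3 where v123: "v = (v1, v2, v3)" "v1 \<in> rcar R" "v2 \<in> rcar R" "v3 \<in> rcar R"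
    using v(1) by (auto simp: vecs_def)
  obtain a1 b1 where 1: "a1 \<in> {0..<5}" "b1 \<in> {0..<5}" "v1 = em a1 b1" using em_surj v123 by blast
  obtain a2 b2 where 2: "a2 \<in> {0..<5}" "b2 \<in> {0..<5}" "v2 = em a2 b2" using em_surj v123 by blast
  obtain a3 b3 where 3: "a3 \<in> {0..<5}" "b3 \<in> {0..<5}" "v3 = em a3 b3" using em_surj v123 by blast
  \<comment> \<open>A generator with all coordinates in the radical is annihilated by
    \<open>em 0 1\<close>, against injectivity.\<close>
  have nz: "a1 \<noteq> 0 \<or> a2 \<noteq> 0 \<or> a3 \<noteq> 0"
  proof (rule ccontr)
    assume "\<not> (a1 \<noteq> 0 \<or> a2 \<noteq> 0 \<or> a3 \<noteq> 0)"
    then have "smul R v (em 0 1) = smul R v (em 0 0)"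
      using v123 1 2 3 by (simp add: smul_def radical_square mul_zero)
    then show False using inj_onD [OF v(2)] radical_closed zero_closed radical_nonzero by blast
  qed
  consider (one) "a1 \<in> {1..<5}" | (two) "a1 = 0" "a2 \<in> {1..<5}" | (three) "a1 = 0" "a2 = 0" "a3 \<in> {1..<5}"
    using nz 1 2 3 by force
  then show ?thesis
  proof cases
    case one
    then obtain w where w: "w \<in> rcar R" "rmul R v1 w = em 1 0" "rmul R w v1 = em 1 0"
      using unit 1 by blast
    obtain y s where y: "y \<in> {0..<5}" "s \<in> {0..<5}" "rmul R v2 w = em y s"
      using em_surj [OF mul_closed [OF v123(3) w(1)]] by blast
    obtain z t where z: "z \<in> {0..<5}" "t \<in> {0..<5}" "rmul R v3 w = em z t"
      using em_surj [OF mul_closed [OF v123(4) w(1)]] by blast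
    have "smul R v w = emb ((1, y, z), (0, s, t))" using w y z v123 by (simp add: smul_def)
    moreover have "((1, y, z), (0, s, t)) \<in> Sigma classes offsets"
      using y z classesI by (auto simp: mem_offsets)
    ultimately show ?thesis using rspan_unit [OF v(1) w(1) v123(2) w(3)] v(3) by metis
  next
    case two
    then obtain w where w: "w \<in> rcar R" "rmul R v2 w = em 1 0" "rmul R w v2 = em 1 0"
      using unit 2 by blast
    obtain s where s: "s \<in> {0..<5}" "rmul R v1 w = em 0 s"
      using radical_mul 1 two w by blast
    obtain z t where z: "z \<in> {0..<5}" "t \<in> {0..<5}" "rmul R v3 w = em z t"
      using em_surj [OF mul_closed [OF v123(4) w(1)]] by blast
    have "smul R v w = emb ((0, 1, z), (s, 0, t))" using w s z v123 by (simp add: smul_def)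
    moreover have "((0, 1, z), (s, 0, t)) \<in> Sigma classes offsets"
      using s z classesI by (auto simp: mem_offsets)
    ultimately show ?thesis using rspan_unit [OF v(1) w(1) v123(3) w(3)] v(3) by metis
  next
    case three
    then obtain w where w: "w \<in> rcar R" "rmul R v3 w = em 1 0" "rmul R w v3 = em 1 0"
      using unit 3 by blast
    obtain s where s: "s \<in> {0..<5}" "rmul R v1 w = em 0 s"
      using radical_mul 1 three w by blast
    obtain t where t: "t \<in> {0..<5}" "rmul R v2 w = em 0 t"
      using radical_mul 2 three w by blast
    have "smul R v w = emb ((0, 0, 1), (s, t, 0))" using w s t v123 by (simp add: smul_def)
    moreover have "((0, 0, 1), (s, t, 0)) \<in> Sigma classes offsets"
      using s t classesI by (auto simp: mem_offsets)
    ultimately show ?thesis using rspan_unit [OF v(1) w(1) v123(4) w(3)] v(3) by metis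
  qed
qed

section \<open>Lines as graphs of linear forms in two coordinates\<close>

lemma graph_line:
  assumes b: "b \<in> rcar R" and c: "c \<in> rcar R"
  shows "{(radd R (rmul R b r) (rmul R c s), r, s) |r s. r \<in> rcar R \<and> s \<in> rcar R} \<in> phg_lines R"
    and "{(r, radd R (rmul R b r) (rmul R c s), s) |r s. r \<in> rcar R \<and> s \<in> rcar R} \<in> phg_lines R"
    and "{(r, s, radd R (rmul R b r) (rmul R c s)) |r s. r \<in> rcar R \<and> s \<in> rcar R} \<in> phg_lines R"
proof -
  note simps = vadd_def smul_def zero_mul one_mul zero_add add_zero
  \<comment> \<open>Freeness is visible because the two parameters reappear as coordinates of the
    vector \<open>g r s\<close>.\<close>
  have free: "free_rank2 R M"
    if "v \<in> vecs R" "w \<in> vecs R" and eq: "\<And>r s. r \<in> rcar R \<Longrightarrow> s \<in> rcar R \<Longrightarrow> vadd R (smul R v r) (smul R w s) = g r s"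
      and inj: "\<And>r s r' s'. g r s = g r' s' \<Longrightarrow> r = r' \<and> s = s'"
      and M: "M = {g r s |r s. r \<in> rcar R \<and> s \<in> rcar R}"
    for v w g M
  proof -
    have "inj_on (\<lambda>(r, s). vadd R (smul R v r) (smul R w s)) (rcar R \<times> rcar R)"
      using inj by (auto simp: inj_on_def eq)
    moreover have "M = (\<lambda>(r, s). vadd R (smul R v r) (smul R w s)) ` (rcar R \<times> rcar R)"
      unfolding M using eq by (force simp: image_iff)
    ultimately show ?thesis unfolding free_rank2_def using that(1,2) by blast
  qed
  show "{(radd R (rmul R b r) (rmul R c s), r, s) |r s. r \<in> rcar R \<and> s \<in> rcar R} \<in> phg_lines R"
    unfolding phg_lines_def mem_Collect_eq
    by (rule free [of "(b, em 1 0, em 0 0)" "(c, em 0 0, em 1 0)"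
          "\<lambda>r s. (radd R (rmul R b r) (rmul R c s), r, s)"])
      (use b c zero_closed one_closed in \<open>auto simp: simps vecs_def\<close>)
  show "{(r, radd R (rmul R b r) (rmul R c s), s) |r s. r \<in> rcar R \<and> s \<in> rcar R} \<in> phg_lines R"
    unfolding phg_lines_def mem_Collect_eq
    by (rule free [of "(em 1 0, b, em 0 0)" "(em 0 0, c, em 1 0)"
          "\<lambda>r s. (r, radd R (rmul R b r) (rmul R c s), s)"])
      (use b c zero_closed one_closed in \<open>auto simp: simps vecs_def\<close>)
  show "{(r, s, radd R (rmul R b r) (rmul R c s)) |r s. r \<in> rcar R \<and> s \<in> rcar R} \<in> phg_lines R"
    unfolding phg_lines_def mem_Collect_eq
    by (rule free [of "(em 1 0, em 0 0, b)" "(em 0 0, em 1 0, c)"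
          "\<lambda>r s. (r, s, radd R (rmul R b r) (rmul R c s))"])
      (use b c zero_closed one_closed in \<open>auto simp: simps vecs_def\<close>)
qed

lemma rmul_linear:
  assumes "b \<in> rcar R" "c \<in> rcar R" "p \<in> rcar R" "q \<in> rcar R" "r \<in> rcar R"
  shows "rmul R (radd R (rmul R b p) (rmul R c q)) r = radd R (rmul R b (rmul R p r)) (rmul R c (rmul R q r))"
  using assms by (simp add: distrib mul_assoc mul_closed)

text \<open>The pivot entry of \<open>l\<close> is -1 and that of \<open>t\<close> is 0, so the
  congruence expresses the pivot coordinate of the point as a linear form in the other two. The
  graph of this form is the line.\<close>

lemma line_exists:
  assumes l: "l \<in> line_classes" and t: "t \<in> offsets l"
  shows "\<exists>L\<in>phg_lines R. \<forall>x\<in>classes. \<forall>s\<in>offsets x.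
    incident x l \<longrightarrow> (carry (dot l x) + dot t x + dot l s) mod 5 = 0 \<longrightarrow> rspan (emb (x, s)) \<subseteq> L"
proof -
  obtain t1 t2 t3 where t123: "t = (t1, t2, t3)" "t1 \<in> {0..<5}" "t2 \<in> {0..<5}" "t3 \<in> {0..<5}" "pivot l (t1, t2, t3) = 0"
    using t by (cases t) (auto simp: mem_offsets)
  have coords: "\<exists>x1 x2 x3 s1 s2 s3. x = (x1, x2, x3) \<and> s = (s1, s2, s3) \<and> {x1, x2, x3, s1, s2, s3} \<subseteq> {0..<5}"
    if "x \<in> classes" "s \<in> offsets x" for x s
    using that by (cases s) (auto elim!: classes_cases simp: mem_offsets)
  from l show ?thesis
  proof (cases rule: line_classes_cases)
    case (1 y z)
    have cl: "em y t2 \<in> rcar R" "em z t3 \<in> rcar R" using 1 t123 em_closed by auto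
    let ?L = "{(radd R (rmul R (em y t2) r) (rmul R (em z t3) s), r, s) |r s. r \<in> rcar R \<and> s \<in> rcar R}"
    have sub: "rspan (emb (x, s)) \<subseteq> ?L"
      if xs: "x \<in> classes" "s \<in> offsets x"
        and inc: "incident x l" "(carry (dot l x) + dot t x + dot l s) mod 5 = 0" for x s
    proof
      fix p assume p: "p \<in> rspan (emb (x, s))"
      obtain x1 x2 x3 s1 s2 s3 where dig: "x = (x1, x2, x3)" "s = (s1, s2, s3)"
        "{x1, x2, x3, s1, s2, s3} \<subseteq> {0..<5}" using coords [OF xs] by blast
      then have cl': "em x2 s2 \<in> rcar R" "em x3 s3 \<in> rcar R" using em_closed by auto
      have "em x1 s1 = radd R (rmul R (em y t2) (em x2 s2)) (rmul R (em z t3) (em x3 s3))"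
        by (rule digit_linear) (use dig inc 1 t123 in \<open>simp_all add: incident_def algebra_simps\<close>)
      then show "p \<in> ?L"
        using p dig cl cl' by (auto simp: rspan_def smul_def rmul_linear mul_closed)
    qed
    show ?thesis by (intro bexI [OF _ graph_line(1) [OF cl]] ballI impI) (rule sub)
  next
    case (2 z)
    have cl: "em 0 t1 \<in> rcar R" "em z t3 \<in> rcar R" using 2 t123 em_closed by auto
    let ?L = "{(r, radd R (rmul R (em 0 t1) r) (rmul R (em z t3) s), s) |r s. r \<in> rcar R \<and> s \<in> rcar R}"
    have sub: "rspan (emb (x, s)) \<subseteq> ?L"
      if xs: "x \<in> classes" "s \<in> offsets x"
        and inc: "incident x l" "(carry (dot l x) + dot t x + dot l s) mod 5 = 0" for x s
    proof
      fix p assume p: "p \<in> rspan (emb (x, s))"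
      obtain x1 x2 x3 s1 s2 s3 where dig: "x = (x1, x2, x3)" "s = (s1, s2, s3)"
        "{x1, x2, x3, s1, s2, s3} \<subseteq> {0..<5}" using coords [OF xs] by blast
      then have cl': "em x1 s1 \<in> rcar R" "em x3 s3 \<in> rcar R" using em_closed by auto
      \<comment> \<open>The coordinates are permuted so that the pivot takes the first place in
        \<open>digit_linear\<close>.\<close>
      have "em x2 s2 = radd R (rmul R (em 0 t1) (em x1 s1)) (rmul R (em z t3) (em x3 s3))"
        by (rule digit_linear) (use dig inc 2 t123 in \<open>simp_all add: incident_def algebra_simps\<close>)
      then show "p \<in> ?L"
        using p dig cl cl' by (auto simp: rspan_def smul_def rmul_linear mul_closed)
    qed
    show ?thesis by (intro bexI [OF _ graph_line(2) [OF cl]] ballI impI) (rule sub)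
  next
    case 3
    have cl: "em 0 t1 \<in> rcar R" "em 0 t2 \<in> rcar R" using 3 t123 em_closed by auto
    let ?L = "{(r, s, radd R (rmul R (em 0 t1) r) (rmul R (em 0 t2) s)) |r s. r \<in> rcar R \<and> s \<in> rcar R}"
    have sub: "rspan (emb (x, s)) \<subseteq> ?L"
      if xs: "x \<in> classes" "s \<in> offsets x"
        and inc: "incident x l" "(carry (dot l x) + dot t x + dot l s) mod 5 = 0" for x s
    proof
      fix p assume p: "p \<in> rspan (emb (x, s))"
      obtain x1 x2 x3 s1 s2 s3 where dig: "x = (x1, x2, x3)" "s = (s1, s2, s3)"
        "{x1, x2, x3, s1, s2, s3} \<subseteq> {0..<5}" using coords [OF xs] by blast
      then have cl': "em x1 s1 \<in> rcar R" "em x2 s2 \<in> rcar R" using em_closed by auto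
      have "em x3 s3 = radd R (rmul R (em 0 t1) (em x1 s1)) (rmul R (em 0 t2) (em x2 s2))"
        by (rule digit_linear) (use dig inc 3 t123 in \<open>simp_all add: incident_def algebra_simps\<close>)
      then show "p \<in> ?L"
        using p dig cl cl' by (auto simp: rspan_def smul_def rmul_linear mul_closed)
    qed
    show ?thesis by (intro bexI [OF _ graph_line(3) [OF cl]] ballI impI) (rule sub)
  qed
qed

section \<open>Transfer to arcs over the ring\<close>

lemma no_44_arc: "\<not> proj_arc R 44 3 K"
proof
  assume arc: "proj_arc R 44 3 K"
  then have K: "K \<subseteq> phg_points R" "card K = 44"
    and lines: "\<And>L. L \<in> phg_lines R \<Longrightarrow> card {P \<in> K. P \<subseteq> L} \<le> 3" by (auto simp: proj_arc_def)
  have finK: "finite K" using K by (metis card.infinite zero_neq_numeral)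
  have "\<exists>p \<in> Sigma classes offsets. P = rspan (emb p)" if "P \<in> K" for P
    using normal_form K that by (auto simp: phg_points_def)
  then obtain g where g: "\<And>P. P \<in> K \<Longrightarrow> g P \<in> Sigma classes offsets \<and> P = rspan (emb (g P))"
    by metis
  \<comment> \<open>A point is recovered from its coordinates as the span of their
    embedding.\<close>
  have inj: "inj_on g K" by (rule inj_onI) (metis g)
  have "card (g ` K) \<noteq> 44"
  proof (rule arc_card_neq_44 [where carry = "\<lambda>l x. carry (dot l x)"])
    show "g ` K \<subseteq> Sigma classes offsets" using g by blast
    fix l t assume "l \<in> line_classes" "t \<in> offsets l"
    then obtain L where L: "L \<in> phg_lines R" "\<forall>x\<in>classes. \<forall>s\<in>offsets x.
        incident x l \<longrightarrow> (carry (dot l x) + dot t x + dot l s) mod 5 = 0 \<longrightarrow> rspan (emb (x, s)) \<subseteq> L"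
      using line_exists by blast
    let ?A = "{(x, s) \<in> g ` K. incident x l \<and> (carry (dot l x) + dot t x + dot l s) mod 5 = 0}"
    have "?A \<subseteq> g ` {P \<in> K. P \<subseteq> L}"
    proof
      fix p assume p: "p \<in> ?A"
      then obtain P where P: "P \<in> K" "p = g P" by auto
      obtain x s where xs: "p = (x, s)" by (cases p)
      then have "x \<in> classes" "s \<in> offsets x" using g [OF P(1)] P(2) by auto
      moreover have "incident x l" "(carry (dot l x) + dot t x + dot l s) mod 5 = 0"
        using p xs by auto
      ultimately have "rspan (emb p) \<subseteq> L" unfolding xs by (rule L(2) [rule_format])
      then show "p \<in> g ` {P \<in> K. P \<subseteq> L}" using P g [OF P(1)] by auto
    qed
    then have "card ?A \<le> card (g ` {P \<in> K. P \<subseteq> L})" by (rule card_mono [rotated]) (use finK in simp)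
    also have "\<dots> \<le> card {P \<in> K. P \<subseteq> L}" by (rule card_image_le) (use finK in simp)
    also have "\<dots> \<le> 3" using lines L by blast
    finally show "card ?A \<le> 3" .
  qed
  then show False using K card_image [OF inj] by simp
qed

text \<open>Subsets of arcs are arcs, so excluding 44 points excludes every larger number.\<close>

lemma m_arc_le_43: "m_arc R 3 \<le> 43"
proof -
  have le: "k \<le> 43" if arc: "proj_arc R k 3 K" for k K
  proof (rule ccontr)
    assume "\<not> k \<le> 43"
    then have "card K \<ge> 44" using arc by (auto simp: proj_arc_def)
    then obtain K' where K': "K' \<subseteq> K" "card K' = 44" by (metis obtain_subset_with_card_n)
    \<comment> \<open>An infinite set would have cardinality 0.\<close>
    have fin: "finite K" using \<open>card K \<ge> 44\<close> by (metis card.infinite not_numeral_le_zero)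
    have "card {P \<in> K'. P \<subseteq> L} \<le> card {P \<in> K. P \<subseteq> L}" for L
      by (rule card_mono) (use fin K' in auto)
    then have "proj_arc R 44 3 K'" using arc K' unfolding proj_arc_def by (meson order_trans)
    then show False using no_44_arc by blast
  qed
  then have "{k. \<exists>K. proj_arc R k 3 K} \<subseteq> {..43}" by auto
  then have fin: "finite {k. \<exists>K. proj_arc R k 3 K}" by (rule finite_subset) simp
  \<comment> \<open>The empty arc makes the set under \<open>Max\<close> nonempty, so that the bound
    on its elements passes to the maximum.\<close>
  have "proj_arc R 0 3 {}" by (simp add: proj_arc_def)
  then have "{k. \<exists>K. proj_arc R k 3 K} \<noteq> {}" by blast
  then show ?thesis unfolding m_arc_def using fin le by (auto simp: Max_le_iff)
qed

end

section \<open>The two rings as instances\<close>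

lemma Z25_unit_check: "\<forall>a\<in>set [1, 2, 3, 4 :: int]. \<forall>b\<in>set [0, 1, 2, 3, 4 :: int]. \<exists>w\<in>set [0..<25].
    (nat (a + 5 * b) * w) mod 25 = 1"
  by code_simp

lemma S5_unit_check: "\<forall>a\<in>set [1, 2, 3, 4 :: int]. \<forall>b\<in>set [0, 1, 2, 3, 4 :: int].
    \<exists>w\<in>set (List.product [0..<5] [0..<5]). rmul S5 (nat a, nat b) w = (1, 0)"
  by code_simp

lemma lt_5: "{0..<5::int} = set [0, 1, 2, 3, 4]" and lt_5': "{1..<5::int} = set [1, 2, 3, 4]"
  by auto

text \<open>Modulo 25 the products of second digits vanish, and the first digits contribute
  \<open>x\<^sub>1 + 5 * m\<close>, where \<open>m\<close> is the carry into the second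
  digit.\<close>

lemma Z25_digit_linear:
  fixes x\<^sub>1 :: int
  assumes dig: "{x\<^sub>1, x\<^sub>2, x\<^sub>3, s\<^sub>1, s\<^sub>2, s\<^sub>3, l\<^sub>2, l\<^sub>3, t\<^sub>2, t\<^sub>3} \<subseteq> {0..<5}"
    and m: "(l\<^sub>2 * x\<^sub>2 + l\<^sub>3 * x\<^sub>3 - x\<^sub>1) mod 5 = 0"
    and k: "((l\<^sub>2 * x\<^sub>2 + l\<^sub>3 * x\<^sub>3 - x\<^sub>1) div 5 + t\<^sub>2 * x\<^sub>2 + t\<^sub>3 * x\<^sub>3 + l\<^sub>2 * s\<^sub>2 + l\<^sub>3 * s\<^sub>3 - s\<^sub>1) mod 5 = 0"
  shows "nat (x\<^sub>1 + 5 * s\<^sub>1) = radd Z25 (rmul Z25 (nat (l\<^sub>2 + 5 * t\<^sub>2)) (nat (x\<^sub>2 + 5 * s\<^sub>2)))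
    (rmul Z25 (nat (l\<^sub>3 + 5 * t\<^sub>3)) (nat (x\<^sub>3 + 5 * s\<^sub>3)))" (is "?l = ?r")
proof -
  define m where "m = (l\<^sub>2 * x\<^sub>2 + l\<^sub>3 * x\<^sub>3 - x\<^sub>1) div 5"
  have m5: "l\<^sub>2 * x\<^sub>2 + l\<^sub>3 * x\<^sub>3 = x\<^sub>1 + 5 * m"
    using \<open>(l\<^sub>2 * x\<^sub>2 + l\<^sub>3 * x\<^sub>3 - x\<^sub>1) mod 5 = 0\<close> unfolding m_def by (simp add: dvd_mult_div_cancel mod_eq_0_iff_dvd)
  obtain k where k5: "m + t\<^sub>2 * x\<^sub>2 + t\<^sub>3 * x\<^sub>3 + l\<^sub>2 * s\<^sub>2 + l\<^sub>3 * s\<^sub>3 - s\<^sub>1 = 5 * k"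
    using k unfolding m_def [symmetric] by (auto simp: mod_eq_0_iff_dvd elim: dvdE)
  have "int ?r = ((l\<^sub>2 + 5 * t\<^sub>2) * (x\<^sub>2 + 5 * s\<^sub>2) + (l\<^sub>3 + 5 * t\<^sub>3) * (x\<^sub>3 + 5 * s\<^sub>3)) mod 25"
    using dig by (simp add: Z25_def zmod_int mod_simps)
  also have "(l\<^sub>2 + 5 * t\<^sub>2) * (x\<^sub>2 + 5 * s\<^sub>2) + (l\<^sub>3 + 5 * t\<^sub>3) * (x\<^sub>3 + 5 * s\<^sub>3)
      = (l\<^sub>2 * x\<^sub>2 + l\<^sub>3 * x\<^sub>3) + 5 * (t\<^sub>2 * x\<^sub>2 + t\<^sub>3 * x\<^sub>3 + l\<^sub>2 * s\<^sub>2 + l\<^sub>3 * s\<^sub>3) + 25 * (t\<^sub>2 * s\<^sub>2 + t\<^sub>3 * s\<^sub>3)"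
    by (simp add: algebra_simps)
  also have "\<dots> = (x\<^sub>1 + 5 * s\<^sub>1) + 25 * (k + t\<^sub>2 * s\<^sub>2 + t\<^sub>3 * s\<^sub>3)"
    using k5 unfolding m5 by (simp add: algebra_simps)
  also have "\<dots> mod 25 = (x\<^sub>1 + 5 * s\<^sub>1) mod 25" by (rule mod_mult_self2)
  also have "\<dots> = x\<^sub>1 + 5 * s\<^sub>1" using dig by (intro mod_pos_pos_trivial) auto
  finally show ?thesis by linarith
qed

lemma S5_digit_linear:
  fixes x\<^sub>1 :: int
  assumes dig: "{x\<^sub>1, x\<^sub>2, x\<^sub>3, s\<^sub>1, s\<^sub>2, s\<^sub>3, l\<^sub>2, l\<^sub>3, t\<^sub>2, t\<^sub>3} \<subseteq> {0..<5}"
    and m: "(l\<^sub>2 * x\<^sub>2 + l\<^sub>3 * x\<^sub>3 - x\<^sub>1) mod 5 = 0"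
    and k: "(t\<^sub>2 * x\<^sub>2 + t\<^sub>3 * x\<^sub>3 + l\<^sub>2 * s\<^sub>2 + l\<^sub>3 * s\<^sub>3 - s\<^sub>1) mod 5 = 0"
  shows "(nat x\<^sub>1, nat s\<^sub>1) = radd S5 (rmul S5 (nat l\<^sub>2, nat t\<^sub>2) (nat x\<^sub>2, nat s\<^sub>2))
    (rmul S5 (nat l\<^sub>3, nat t\<^sub>3) (nat x\<^sub>3, nat s\<^sub>3))" (is "_ = ?r")
proof -
  have digit: "q mod 5 = p" if "(q - p) mod 5 = 0" "p \<in> {0..<5}" for p q :: int
    using that by (simp, presburger)
  have "int (fst ?r) = (l\<^sub>2 * x\<^sub>2 + l\<^sub>3 * x\<^sub>3) mod 5"
    using dig by (simp add: S5_def zmod_int mod_simps)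
  also have "\<dots> = x\<^sub>1" by (rule digit) (use m dig in auto)
  finally have 1: "fst ?r = nat x\<^sub>1" by linarith
  have "int (snd ?r) = (l\<^sub>2 * s\<^sub>2 + t\<^sub>2 * x\<^sub>2 + (l\<^sub>3 * s\<^sub>3 + t\<^sub>3 * x\<^sub>3)) mod 5"
    using dig by (simp add: S5_def zmod_int mod_simps)
  also have "\<dots> = (t\<^sub>2 * x\<^sub>2 + t\<^sub>3 * x\<^sub>3 + l\<^sub>2 * s\<^sub>2 + l\<^sub>3 * s\<^sub>3) mod 5"
    by (simp add: ac_simps)
  also have "\<dots> = s\<^sub>1" by (rule digit) (use k dig in auto)
  finally have 2: "snd ?r = nat s\<^sub>1" by linarith
  show ?thesis using 1 2 by (simp add: prod_eq_iff)
qed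

interpretation Z25: digit_ring Z25 "\<lambda>a b. nat (a + 5 * b)" "\<lambda>n. n div 5"
proof
  fix r assume "r \<in> rcar Z25"
  then have "r < 25" by (simp add: Z25_def)
  then show "\<exists>a\<in>{0..<5}. \<exists>b\<in>{0..<5}. r = nat (a + 5 * b)"
    by (intro bexI [of _ "int r mod 5"] bexI [of _ "int r div 5"]) (simp, auto)
next
  fix a b :: int assume "a \<in> {1..<5}" "b \<in> {0..<5}"
  then obtain w where "w < 25" "(nat (a + 5 * b) * w) mod 25 = 1"
    using Z25_unit_check unfolding lt_5 lt_5' by (metis atLeastLessThan_iff set_upt)
  then show "\<exists>w\<in>rcar Z25. rmul Z25 (nat (a + 5 * b)) w = nat (1 + 5 * 0)
      \<and> rmul Z25 w (nat (a + 5 * b)) = nat (1 + 5 * 0)"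
    by (intro bexI [of _ w]) (auto simp: Z25_def mult.commute)
next
  fix b :: int and w assume b: "b \<in> {0..<5}" and "w \<in> rcar Z25"
  \<comment> \<open>The factor 5 is pulled out of the residue modulo 25, which leaves
    \<open>b * w\<close> modulo 5 as the second digit.\<close>
  have "int (rmul Z25 (nat (0 + 5 * b)) w) = (5 * (b * int w)) mod (5 * 5)"
    using b by (simp add: Z25_def zmod_int mult.assoc)
  also have "\<dots> = 5 * ((b * int w) mod 5)" by (rule mult_mod_right [symmetric])
  finally show "\<exists>b'\<in>{0..<5}. rmul Z25 (nat (0 + 5 * b)) w = nat (0 + 5 * b')"
    by (intro bexI [of _ "(b * int w) mod 5"]) (simp, auto)
next
  fix b :: int assume "b \<in> {0..<5}"
  then show "rmul Z25 (nat (0 + 5 * b)) (nat (0 + 5 * 1)) = nat (0 + 5 * 0)"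
    by (auto simp: lt_5 Z25_def)
next
  fix p q r
  show "rmul Z25 (rmul Z25 p q) r = rmul Z25 p (rmul Z25 q r)"
    by (simp add: Z25_def mod_simps mult.assoc)
  show "rmul Z25 (radd Z25 p q) r = radd Z25 (rmul Z25 p r) (rmul Z25 q r)"
    by (simp add: Z25_def mod_simps distrib_right)
next
  fix x\<^sub>1 x\<^sub>2 x\<^sub>3 s\<^sub>1 s\<^sub>2 s\<^sub>3 l\<^sub>2 l\<^sub>3 t\<^sub>2 t\<^sub>3 :: int
  assume "{x\<^sub>1, x\<^sub>2, x\<^sub>3, s\<^sub>1, s\<^sub>2, s\<^sub>3, l\<^sub>2, l\<^sub>3, t\<^sub>2, t\<^sub>3} \<subseteq> {0..<5}"
    "(l\<^sub>2 * x\<^sub>2 + l\<^sub>3 * x\<^sub>3 - x\<^sub>1) mod 5 = 0"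
    "((l\<^sub>2 * x\<^sub>2 + l\<^sub>3 * x\<^sub>3 - x\<^sub>1) div 5 + t\<^sub>2 * x\<^sub>2 + t\<^sub>3 * x\<^sub>3 + l\<^sub>2 * s\<^sub>2 + l\<^sub>3 * s\<^sub>3 - s\<^sub>1) mod 5 = 0"
  then show "nat (x\<^sub>1 + 5 * s\<^sub>1) = radd Z25 (rmul Z25 (nat (l\<^sub>2 + 5 * t\<^sub>2)) (nat (x\<^sub>2 + 5 * s\<^sub>2)))
      (rmul Z25 (nat (l\<^sub>3 + 5 * t\<^sub>3)) (nat (x\<^sub>3 + 5 * s\<^sub>3)))"
    by (rule Z25_digit_linear)
qed (auto simp: Z25_def nat_less_iff)

interpretation S5: digit_ring S5 "\<lambda>a b. (nat a, nat b)" "\<lambda>n. 0"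
proof
  fix r assume "r \<in> rcar S5"
  then show "\<exists>a\<in>{0..<5}. \<exists>b\<in>{0..<5}. r = (nat a, nat b)"
    by (intro bexI [of _ "int (fst r)"] bexI [of _ "int (snd r)"]) (auto simp: S5_def)
next
  fix a b :: int assume "a \<in> {1..<5}" "b \<in> {0..<5}"
  then obtain w where w: "w \<in> set (List.product [0..<5] [0..<5])" "rmul S5 (nat a, nat b) w = (1, 0)"
    using S5_unit_check unfolding lt_5 lt_5' by blast
  moreover have "rmul S5 w (nat a, nat b) = rmul S5 (nat a, nat b) w"
    by (cases w) (simp add: S5_def mult.commute add.commute)
  ultimately show "\<exists>w\<in>rcar S5. rmul S5 (nat a, nat b) w = (nat 1, nat 0)
      \<and> rmul S5 w (nat a, nat b) = (nat 1, nat 0)"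
    by (intro bexI [of _ w]) (auto simp: S5_def)
next
  fix b :: int and w assume "b \<in> {0..<5}" and "w \<in> rcar S5"
  then show "\<exists>b'\<in>{0..<5}. rmul S5 (nat 0, nat b) w = (nat 0, nat b')"
    by (intro bexI [of _ "int ((nat b * fst w) mod 5)"]) (auto simp: S5_def)
next
  fix p q r
  have red: "(a mod 5 * b + c mod 5 * d) mod 5 = (a * b + c * d) mod 5"
    "(b * (a mod 5) + d * (c mod 5)) mod 5 = (b * a + d * c) mod 5" for a b c d :: nat
    by (intro mod_add_cong mod_mult_cong; simp)+
  show "rmul S5 (rmul S5 p q) r = rmul S5 p (rmul S5 q r)"
    by (cases p; cases q; cases r) (simp add: S5_def red mod_simps, simp add: algebra_simps)
  show "rmul S5 (radd S5 p q) r = radd S5 (rmul S5 p r) (rmul S5 q r)"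
    by (cases p; cases q; cases r) (simp add: S5_def red mod_simps, simp add: algebra_simps)
next
  fix x\<^sub>1 x\<^sub>2 x\<^sub>3 s\<^sub>1 s\<^sub>2 s\<^sub>3 l\<^sub>2 l\<^sub>3 t\<^sub>2 t\<^sub>3 :: int
  assume "{x\<^sub>1, x\<^sub>2, x\<^sub>3, s\<^sub>1, s\<^sub>2, s\<^sub>3, l\<^sub>2, l\<^sub>3, t\<^sub>2, t\<^sub>3} \<subseteq> {0..<5}"
    "(l\<^sub>2 * x\<^sub>2 + l\<^sub>3 * x\<^sub>3 - x\<^sub>1) mod 5 = 0"
    "(0 + t\<^sub>2 * x\<^sub>2 + t\<^sub>3 * x\<^sub>3 + l\<^sub>2 * s\<^sub>2 + l\<^sub>3 * s\<^sub>3 - s\<^sub>1) mod 5 = 0"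
  then show "(nat x\<^sub>1, nat s\<^sub>1) = radd S5 (rmul S5 (nat l\<^sub>2, nat t\<^sub>2) (nat x\<^sub>2, nat s\<^sub>2))
      (rmul S5 (nat l\<^sub>3, nat t\<^sub>3) (nat x\<^sub>3, nat s\<^sub>3))"
    by (intro S5_digit_linear) (simp_all only: add_0)
qed (auto simp: S5_def)

theorem theorem4p22:
  shows "m_arc Z25 3 \<le> 43 \<and> m_arc S5 3 \<le> 43"
  using Z25.m_arc_le_43 S5.m_arc_le_43 by blast

end
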